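(* Let $L$ be an oriented link with components $L_1,\ldots,L_k$. The total dimension over $\mathbb{F}_2$ of the filtered Bar-Natan homology $\mathrm{BN}^*(L)'$ is $2^k$. Moreover, for every $i\in\mathbb{Z}$, $$\dim_{\mathbb{F}_2} \mathrm{BN}^i(L)' = \mathrm{Card}\Big\{E\subset\{1,2,\ldots,k\} \;\Big|\; 2\sum_{l\in E,\, m\notin E}\mathrm{lk}(L_l,L_m)=i\Big\},$$ where $\mathrm{lk}(L_l,L_m)$ is the linking number between $L_l$ and $L_m$.
   Context: Let $D$ be a diagram of the oriented link $L$ with $n$ ordered crossings, $n_+$ positive and $n_-$ negative. For $\alpha\in\{0,1\}^n$ let $D_\alpha$ be the complete smoothing of $D$ in which the $r$-th crossing receives its $\alpha_r$-smoothing (standard Khovanov/Bar-Natan convention: the oriented smoothing of a positive crossing is its 0-smoothing and of a negative crossing its 1-smoothing). Let $A=\mathbb{F}_2\{1,x\}$ and $V_\alpha=A^{\otimes(\text{circles of }D_\alpha)}$, and set $\overline{\mathcal C}^{i}(D)=\bigoplus_{|\alpha|-n_-=i}V_\alpha$, where $|\alpha|$ is the number of 1's in $\alpha$. Equip $A$ with the multiplication and comultiplication (Bar-Natan's characteristic two theory with $u=1$) $$m(1,1)=1,\quad m(1,x)=m(x,1)=x,\quad m(x,x)=x,$$ $$\Delta(1)=1\otimes x+x\otimes 1+1\otimes 1,\quad \Delta(x)=x\otimes x.$$ For each edge $\alpha\to\alpha'$ of the cube $\{0,1\}^n$ (one entry changes from 0 to 1), either two circles merge or one circle splits; the edge map $V_\alpha\to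 V_{\alpha'}$ applies $m$ or $\Delta$ respectively to the circles involved and the identity to the other tensor factors. The differential $d\colon\overline{\mathcal C}^{i}(D)\to\overline{\mathcal C}^{i+1}(D)$ is given on $V_\alpha$ by the sum of the edge maps over all edges with tail $\alpha$. The filtered Bar-Natan homology $\mathrm{BN}^*(L)'$ is the homology of $(\overline{\mathcal C}^*(D),d)$; up to isomorphism it does not depend on the diagram $D$. *)

theory Defs
  imports
    "Jordan_Normal_Form.VS_Connect"
    "HOL-Algebra.AbelCoset"
    "HOL-Library.Z2"
begin

section \<open>Oriented link diagrams\<close>

text \<open>
  An oriented link diagram is encoded by an oriented planar diagram code.  Removing the crossings
  from the diagram leaves finitely many oriented arcs, which are named by natural numbers; an arc
  is either a component without crossings (a loop) or runs from a crossing to a crossing.  A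
  crossing records its sign and the arcs by which the lower and the upper strand enter and leave it.
\<close>

type_synonym arc = nat

record crossing =
  positive :: bool
  under_in :: arc
  under_out :: arc
  over_in :: arc
  over_out :: arc

record diagram =
  crossings :: "crossing list"
  loops :: "arc set"

text \<open>
  The four ends at a crossing, counterclockwise from the incoming lower one, each with a flag
  telling whether the arc leaves the crossing there.  The lower strand thus runs from position 0
  to position 2, and the upper strand from 3 to 1 at a positive and from 1 to 3 at a negative
  crossing.
\<close>

definition ends :: "crossing \<Rightarrow> (arc \<times> bool) list" where
  "ends c =
    (if positive c
     then [(under_in c, False), (over_out c, True), (under_out c, True), (over_in c, False)]
     else [(under_in c, False), (over_in c, False), (under_out c, True), (over_out c, True)])"

definition slot :: "crossing \<Rightarrow> nat \<Rightarrow> arc" where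
  "slot c j = fst (ends c ! j)"

definition in_arcs :: "diagram \<Rightarrow> arc list" where
  "in_arcs D = concat (map (\<lambda>c. [under_in c, over_in c]) (crossings D))"

definition out_arcs :: "diagram \<Rightarrow> arc list" where
  "out_arcs D = concat (map (\<lambda>c. [under_out c, over_out c]) (crossings D))"

definition arcs :: "diagram \<Rightarrow> arc set" where
  "arcs D = set (in_arcs D) \<union> set (out_arcs D) \<union> loops D"

definition generated_classes :: "'a set \<Rightarrow> ('a \<Rightarrow> 'a \<Rightarrow> bool) \<Rightarrow> 'a set set" where
  "generated_classes A r = A // {(x, y). equivclp r x y}"

definition strand :: "diagram \<Rightarrow> arc \<Rightarrow> arc \<Rightarrow> bool" where
  "strand D a b \<longleftrightarrow> (\<exists>c \<in> set (crossings D).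
     (a, b) = (under_in c, under_out c) \<or> (a, b) = (over_in c, over_out c))"

text \<open>A link component is represented by the set of its arcs.\<close>

definition components :: "diagram \<Rightarrow> arc set set" where
  "components D = generated_classes (arcs D) (strand D)"

definition share_crossing :: "diagram \<Rightarrow> arc \<Rightarrow> arc \<Rightarrow> bool" where
  "share_crossing D a b \<longleftrightarrow>
     (\<exists>c \<in> set (crossings D). \<exists>i<4. \<exists>j<4. a = slot c i \<and> b = slot c j)"

text \<open>The connected components of the underlying plane curve.\<close>

definition pieces :: "diagram \<Rightarrow> arc set set" where
  "pieces D = generated_classes (arcs D) (share_crossing D)"

text \<open>
  The pair \<open>(a, True)\<close> is the left side of the arc \<open>a\<close> and \<open>(a, False)\<close> its right side.  Between
  an end at a crossing and the counterclockwise next one lies a corner, which connects the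
  counterclockwise side of the first end with the clockwise side of the second.  Seen from the
  crossing, the counterclockwise side is the left side of an outgoing arc but the right side of
  an incoming one.
\<close>

definition corner :: "diagram \<Rightarrow> arc \<times> bool \<Rightarrow> arc \<times> bool \<Rightarrow> bool" where
  "corner D x y \<longleftrightarrow> (\<exists>c \<in> set (crossings D). \<exists>j<4.
     x = ends c ! j \<and>
     y = (fst (ends c ! ((j + 1) mod 4)), \<not> snd (ends c ! ((j + 1) mod 4))))"

definition faces :: "diagram \<Rightarrow> (arc \<times> bool) set set" where
  "faces D = generated_classes (arcs D \<times> UNIV) (corner D)"

text \<open>
  The last clause is Euler's formula, which says that the code comes from a diagram in the plane
  (or sphere) and not just from one on a surface of higher genus.  The faces are counted
  separately for each piece, so every piece contributes at most 2 to the left hand side, and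
  exactly 2 iff it is planar.  A loop contributes no vertex, no edge and its two sides.
\<close>

definition link_diagram :: "diagram \<Rightarrow> bool" where
  "link_diagram D \<longleftrightarrow>
     finite (loops D) \<and>
     distinct (in_arcs D) \<and> distinct (out_arcs D) \<and>
     set (in_arcs D) = set (out_arcs D) \<and>
     loops D \<inter> set (in_arcs D) = {} \<and>
     int (length (crossings D)) - int (card (set (in_arcs D))) + int (card (faces D))
       = 2 * int (card (pieces D))"

definition crossing_sign :: "crossing \<Rightarrow> int" where
  "crossing_sign c = (if positive c then 1 else - 1)"

definition n_minus :: "diagram \<Rightarrow> nat" where
  "n_minus D = length (filter (\<lambda>c. \<not> positive c) (crossings D))"

text \<open>The linking number of two distinct components.\<close>

definition lk :: "diagram \<Rightarrow> arc set \<Rightarrow> arc set \<Rightarrow> rat" where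
  "lk D K L = of_int (\<Sum>c \<leftarrow> filter (\<lambda>c. under_in c \<in> K \<and> over_in c \<in> L \<or>
                                          under_in c \<in> L \<and> over_in c \<in> K) (crossings D).
                        crossing_sign c) / 2"

section \<open>Smoothings\<close>

definition vertices :: "diagram \<Rightarrow> bool list set" where
  "vertices D = {\<alpha>. length \<alpha> = length (crossings D)}"

text \<open>
  With the ends of a crossing numbered as in \<^const>\<open>ends\<close>, the 0-smoothing connects 0 with 1 and
  2 with 3, and the 1-smoothing connects 0 with 3 and 1 with 2.
\<close>

definition smoothing :: "diagram \<Rightarrow> bool list \<Rightarrow> arc \<Rightarrow> arc \<Rightarrow> bool" where
  "smoothing D \<alpha> a b \<longleftrightarrow> (\<exists>r < length (crossings D). let c = crossings D ! r in
     if \<alpha> ! r then (a, b) = (slot c 0, slot c 3) \<or> (a, b) = (slot c 1, slot c 2)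
     else (a, b) = (slot c 0, slot c 1) \<or> (a, b) = (slot c 2, slot c 3))"

definition circles :: "diagram \<Rightarrow> bool list \<Rightarrow> arc set set" where
  "circles D \<alpha> = generated_classes (arcs D) (smoothing D \<alpha>)"

definition circle_of :: "diagram \<Rightarrow> bool list \<Rightarrow> arc \<Rightarrow> arc set" where
  "circle_of D \<alpha> a = {b. equivclp (smoothing D \<alpha>) a b}"

section \<open>The filtered Bar-Natan complex\<close>

text \<open>
  The basis elements 1 and \<open>x\<close> of \<open>A\<close>.  The product of two of them is again a basis element, and a
  coproduct, being an element of an \<open>\<bbbF>\<^sub>2\<close>-vector space with a basis, is given as the set of
  the basis elements \<open>a \<otimes> b\<close> that occur in it.
\<close>

datatype gen = One | X

fun mult_A :: "gen \<Rightarrow> gen \<Rightarrow> gen" where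
  "mult_A One One = One"
| "mult_A One X = X"
| "mult_A X One = X"
| "mult_A X X = X"

fun comult_A :: "gen \<Rightarrow> (gen \<times> gen) set" where
  "comult_A One = {(One, X), (X, One), (One, One)}"
| "comult_A X = {(X, X)}"

text \<open>The standard basis of \<open>V\<^sub>\<alpha>\<close>.\<close>

definition labelings :: "diagram \<Rightarrow> bool list \<Rightarrow> (arc set \<Rightarrow> gen) set" where
  "labelings D \<alpha> = circles D \<alpha> \<rightarrow>\<^sub>E UNIV"

text \<open>
  The coefficient of the basis element \<open>s'\<close> in the image of the basis element \<open>s\<close> under the edge
  map \<open>V\<^sub>\<alpha> \<rightarrow> V\<^sub>\<alpha>\<^sub>'\<close>, where \<open>\<alpha>'\<close> arises from \<open>\<alpha>\<close> by changing the entry \<open>r\<close> from 0 to 1.  The ends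
  0 and 2 of a crossing are on different strands of either smoothing, so \<open>P\<close>, \<open>Q\<close> and \<open>P'\<close>, \<open>Q'\<close>
  are the circles through the crossing.  In a planar diagram the last case does not occur.
\<close>

definition edge_coeff ::
  "diagram \<Rightarrow> nat \<Rightarrow> bool list \<Rightarrow> (arc set \<Rightarrow> gen) \<Rightarrow> (arc set \<Rightarrow> gen) \<Rightarrow> bit" where
  "edge_coeff D r \<alpha> s s' =
    (let \<alpha>' = \<alpha>[r := True]; c = crossings D ! r;
         P = circle_of D \<alpha> (slot c 0); Q = circle_of D \<alpha> (slot c 2);
         P' = circle_of D \<alpha>' (slot c 0); Q' = circle_of D \<alpha>' (slot c 2)
     in if \<exists>C \<in> circles D \<alpha> - {P, Q}. s' C \<noteq> s C then 0
        else if P \<noteq> Q \<and> P' = Q' then of_bool (s' P' = mult_A (s P) (s Q))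
        else if P = Q \<and> P' \<noteq> Q' then of_bool ((s' P', s' Q') \<in> comult_A (s P))
        else 0)"

type_synonym state = "bool list \<times> (arc set \<Rightarrow> gen)"

definition states :: "diagram \<Rightarrow> state set" where
  "states D = (SIGMA \<alpha> : vertices D. labelings D \<alpha>)"

definition degree_states :: "diagram \<Rightarrow> int \<Rightarrow> state set" where
  "degree_states D i =
     {(\<alpha>, s) \<in> states D. int (count_list \<alpha> True) - int (n_minus D) = i}"

text \<open>
  A chain is the function that maps each basis element to its coefficient.  (The ring
  multiplication and the ring unit of a \<open>module\<close> record are without meaning.)
\<close>

type_synonym chain = "state \<Rightarrow> bit"

definition chain_space :: "diagram \<Rightarrow> int \<Rightarrow> (bit, chain) module" where
  "chain_space D i =
    \<lparr>carrier = {f. \<forall>g. g \<notin> degree_states D i \<longrightarrow> f g = 0},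
     mult = undefined, one = undefined,
     zero = (\<lambda>g. 0), add = (\<lambda>f f' g. f g + f' g),
     smult = (\<lambda>k f g. k * f g)\<rparr>"

definition differential :: "diagram \<Rightarrow> chain \<Rightarrow> chain" where
  "differential D f = (\<lambda>(\<alpha>', s').
     if (\<alpha>', s') \<in> states D
     then \<Sum>(\<alpha>, s) \<in> states D.
            \<Sum>r | r < length (crossings D) \<and> \<not> \<alpha> ! r \<and> \<alpha>' = \<alpha>[r := True].
              edge_coeff D r \<alpha> s s' * f (\<alpha>, s)
     else 0)"

definition cycles :: "diagram \<Rightarrow> int \<Rightarrow> chain set" where
  "cycles D i = {f \<in> carrier (chain_space D i). differential D f = (\<lambda>g. 0)}"

definition boundaries :: "diagram \<Rightarrow> int \<Rightarrow> chain set" where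
  "boundaries D i = differential D ` carrier (chain_space D (i - 1))"

definition quotient_space :: "('k, 'v) module \<Rightarrow> 'v set \<Rightarrow> ('k, 'v set) module" where
  "quotient_space V B =
    \<lparr>carrier = a_rcosets\<^bsub>V\<^esub> B,
     mult = undefined, one = undefined,
     zero = B, add = set_add V,
     smult = (\<lambda>k S. \<Union>v \<in> S. B +>\<^bsub>V\<^esub> (k \<odot>\<^bsub>V\<^esub> v))\<rparr>"

definition BN :: "diagram \<Rightarrow> int \<Rightarrow> (bit, chain set) module" where
  "BN D i = quotient_space (chain_space D i \<lparr>carrier := cycles D i\<rparr>) (boundaries D i)"

abbreviation BN_dim :: "diagram \<Rightarrow> int \<Rightarrow> nat" where
  "BN_dim D i \<equiv> vectorspace.dim (class_ring :: bit ring) (BN D i)"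

end

theory Submission
  imports Defs "HOL-Combinatorics.Orbits"
begin

text \<open>
  The elements \<open>x\<close> and \<open>y = 1 + x\<close> are orthogonal idempotents of \<open>A\<close> with sum 1, and they satisfy
  \<open>\<Delta>(x) = x \<otimes> x\<close> and \<open>\<Delta>(y) = y \<otimes> y\<close>.  In the corresponding basis of the chain complex, a basis element
  is a smoothing together with a colouring of its circles by \<open>x\<close> and \<open>y\<close>, and an edge map sends it
  to the same colouring of the arcs if this is still constant on circles, and to 0 otherwise
  (\<open>sum_edge_coeff\<close>, \<open>color_sum_differential\<close>).  The complex thus decomposes over the colourings of
  the arcs.  At a crossing where a colouring takes both values at most one of the two smoothings is
  compatible with it; where it is constant, both are.  Hence the summand of a colouring is zero or a
  cube with one direction for each monochromatic crossing.  It is acyclic if there is such a crossing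
  and otherwise a single generator (\<open>BN_dim_eq\<close>).

  Planarity enters through a checkerboard colouring of the faces.  Modulo 2 the union of all arcs is
  a cycle, as all crossings have valency 4, and Euler's formula makes every cycle a boundary
  (\<open>checkerboard_exists\<close>).  Orienting the arcs with the black faces to their left makes the circles of
  all smoothings the cycles of permutations, and changing one crossing multiplies such a permutation
  by a transposition.  So an edge always merges two circles or splits one
  (\<open>circles_merge_or_split\<close>).

  Finally, a colouring without monochromatic crossings that is compatible with some smoothing is the
  same as an orientation of the link: colour each arc by the colour of the face on its left.
  Orientations are described by the set \<open>E\<close> of the components whose given orientation is reversed.
  The smoothing is then the one respecting the new orientation, which differs from the one for the
  given orientation at the crossings between \<open>E\<close> and its complement.  The degree is therefore the sum
  of the signs of these crossings, that is, twice the total linking number between \<open>E\<close> and its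
  complement (\<open>generators_iff\<close>, \<open>degree_smoothing_of\<close>, \<open>twice_linking_number\<close>).
\<close>

section \<open>Saturated sets\<close>

text \<open>
  Components, pieces, faces and circles all arise as the classes of the equivalence relation
  generated by some relation.  A two-colouring that is constant on such classes is the
  indicator function of one of the following sets.
\<close>

definition saturated :: "'a set \<Rightarrow> ('a \<Rightarrow> 'a \<Rightarrow> bool) \<Rightarrow> 'a set set" where
  "saturated A r = {U. U \<subseteq> A \<and> (\<forall>a b. r a b \<longrightarrow> (a \<in> U \<longleftrightarrow> b \<in> U))}"

lemma saturated_equivclp:
  assumes "U \<in> saturated A r" "equivclp r a b"
  shows "a \<in> U \<longleftrightarrow> b \<in> U"
  using assms(2,1) by (induction rule: equivclp_induct) (auto simp: saturated_def)

lemma equivclp_refl: "equivclp r a a"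
  by (rule reflpD[OF reflp_equivclp])

lemma r_into_equivclp: "r a b \<Longrightarrow> equivclp r a b"
  by (simp add: equivclp_def r_into_rtranclp symclpI)

lemma equivclp_trans [trans]: "equivclp r a b \<Longrightarrow> equivclp r b c \<Longrightarrow> equivclp r a c"
  by (rule transpD[OF transp_equivclp])

lemma equivclp_class_eq: "{b. equivclp r a b} = {b. equivclp r a' b} \<longleftrightarrow> equivclp r a a'"
proof
  assume "{b. equivclp r a b} = {b. equivclp r a' b}"
  thus "equivclp r a a'" using equivclp_refl[of r a'] by blast
next
  assume "equivclp r a a'"
  thus "{b. equivclp r a b} = {b. equivclp r a' b}"
    using equivclp_trans equivclp_sym by (metis (full_types))
qed

lemma generated_classes_eq: "generated_classes A r = (\<lambda>a. {b. equivclp r a b}) ` A"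
  by (auto simp: generated_classes_def quotient_def)

lemma finite_saturated: "finite A \<Longrightarrow> finite (saturated A r)"
  by (rule finite_subset[of _ "Pow A"]) (auto simp: saturated_def)

lemma saturated_sym_diff:
  "U \<in> saturated A r \<Longrightarrow> V \<in> saturated A r \<Longrightarrow> sym_diff U V \<in> saturated A r"
  unfolding saturated_def by blast

lemma saturated_class:
  assumes "\<And>a b. r a b \<Longrightarrow> a \<in> A \<and> b \<in> A" "a \<in> A"
  shows "{b. equivclp r a b} \<in> saturated A r"
proof -
  have "equivclp r a b \<Longrightarrow> b \<in> A" for b
    by (induction rule: equivclp_induct) (use assms in auto)
  moreover have "equivclp r a b \<longleftrightarrow> equivclp r a c" if "r b c" for b c
    using that by (meson equivclp_trans equivclp_sym r_into_equivclp)
  ultimately show ?thesis by (auto simp: saturated_def)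
qed

lemma bij_betw_Union_classes:
  assumes "\<And>a b. r a b \<Longrightarrow> a \<in> A \<and> b \<in> A"
  shows "bij_betw Union (Pow (generated_classes A r)) (saturated A r)"
proof (rule bij_betwI')
  fix X Y assume X: "X \<in> Pow (generated_classes A r)" and Y: "Y \<in> Pow (generated_classes A r)"
  have *: "c \<in> X \<longleftrightarrow> c \<subseteq> \<Union> X"
    if X: "X \<subseteq> generated_classes A r" and c: "c \<in> generated_classes A r" for X c
  proof
    assume sub: "c \<subseteq> \<Union> X"
    obtain a where a: "c = {b. equivclp r a b}" using c by (auto simp: generated_classes_eq)
    then obtain d where d: "d \<in> X" "a \<in> d" using sub equivclp_refl by (metis UnionE mem_Collect_eq subsetD)
    then obtain a' where a': "d = {b. equivclp r a' b}" using X by (auto simp: generated_classes_eq)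
    have "equivclp r a' a" using d(2) a' by simp
    hence "c = d" unfolding a a' equivclp_class_eq by (rule equivclp_sym)
    thus "c \<in> X" using d by simp
  qed auto
  show "\<Union> X = \<Union> Y \<longleftrightarrow> X = Y"
    using *[of X] *[of Y] X Y by (metis Pow_iff subsetD subset_antisym subsetI)
next
  fix X assume X: "X \<in> Pow (generated_classes A r)"
  have "c \<in> saturated A r" if "c \<in> X" for c
    using X that saturated_class[OF assms] by (auto simp: generated_classes_eq)
  thus "\<Union> X \<in> saturated A r" unfolding saturated_def by blast
next
  fix U assume U: "U \<in> saturated A r"
  let ?X = "(\<lambda>a. {b. equivclp r a b}) ` U"
  have "U \<subseteq> A" using U by (auto simp: saturated_def)
  hence "?X \<in> Pow (generated_classes A r)" by (auto simp: generated_classes_eq)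
  moreover have "U = \<Union> ?X"
    using saturated_equivclp[OF U] equivclp_refl[of r] by blast
  ultimately show "\<exists>X\<in>Pow (generated_classes A r). U = \<Union> X" by blast
qed

lemma card_saturated:
  assumes "finite A" "\<And>a b. r a b \<Longrightarrow> a \<in> A \<and> b \<in> A"
  shows "card (saturated A r) = 2 ^ card (generated_classes A r)"
proof -
  have "finite (generated_classes A r)" using assms(1) by (simp add: generated_classes_eq)
  thus ?thesis
    using bij_betw_same_card[OF bij_betw_Union_classes[of r A, OF assms(2)]] by (simp add: card_Pow)
qed

text \<open>
  The involution pairs off elements with equal values, which cancel modulo 2; the property picks
  one element of each pair.
\<close>

lemma sum_bit_involution:
  fixes f :: "'a \<Rightarrow> bit"
  assumes "finite M" "\<And>x. x \<in> M \<Longrightarrow> i x \<in> M" "\<And>x. x \<in> M \<Longrightarrow> i (i x) = x"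
    and "\<And>x. x \<in> M \<Longrightarrow> P (i x) \<longleftrightarrow> \<not> P x" "\<And>x. x \<in> M \<Longrightarrow> f (i x) = f x"
  shows "sum f M = 0"
proof -
  have "sum f {x \<in> M. P x} = sum f {x \<in> M. \<not> P x}"
    by (rule sum.reindex_bij_witness[of _ i i]) (use assms in auto)
  moreover have "sum f M = sum f {x \<in> M. P x} + sum f {x \<in> M. \<not> P x}"
    by (subst sum.union_disjoint[symmetric]) (use assms(1) in \<open>auto intro: arg_cong2[where f=sum]\<close>)
  ultimately show ?thesis by simp
qed

text \<open>
  An interval \<open>S \<subset> R\<close> of saturated sets has an even number of elements, because a class
  inside \<open>R - S\<close> can be toggled.  This is what makes the change between the bases
  \<open>1, x\<close> and \<open>1 + x, x\<close> of \<open>A\<close> an involution, here expressed by sums over supersets.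
\<close>

lemma sum_saturated_interval:
  assumes "finite A" "\<And>a b. r a b \<Longrightarrow> a \<in> A \<and> b \<in> A"
    and S: "S \<in> saturated A r" and R: "R \<in> saturated A r" and SR: "S \<subseteq> R"
  shows "(\<Sum>U | U \<in> saturated A r \<and> S \<subseteq> U \<and> U \<subseteq> R. (1::bit)) = of_bool (S = R)"
proof (cases "S = R")
  case True
  have "{U \<in> saturated A r. S \<subseteq> U \<and> U \<subseteq> R} = {R}" using True R by auto
  thus ?thesis using True by simp
next
  case False
  then obtain a where a: "a \<in> R" "a \<notin> S" using SR by auto
  define C where "C = {b. equivclp r a b}"
  have C: "C \<in> saturated A r"
    using R a unfolding C_def by (intro saturated_class assms) (auto simp: saturated_def)
  have aC: "a \<in> C" unfolding C_def by (simp add: equivclp_refl)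
  have CR: "C \<subseteq> R" and CS: "C \<inter> S = {}"
    using saturated_equivclp[OF R] saturated_equivclp[OF S] a unfolding C_def by blast+
  have "(\<Sum>U | U \<in> saturated A r \<and> S \<subseteq> U \<and> U \<subseteq> R. (1::bit)) = 0"
  proof (rule sum_bit_involution[where i = "\<lambda>U. sym_diff U C" and P = "\<lambda>U. a \<in> U"])
    show "finite {U \<in> saturated A r. S \<subseteq> U \<and> U \<subseteq> R}" using finite_saturated[OF assms(1)] by simp
  qed (use C CR CS aC in \<open>auto intro: saturated_sym_diff\<close>)
  thus ?thesis using False by simp
qed

section \<open>Counting over the field with two elements\<close>

lemma character_sum:
  fixes a :: "'a \<Rightarrow> nat"
  assumes "finite I"
  shows "(\<Sum>Y\<in>Pow I. (-1 :: int) ^ (\<Sum>i\<in>Y. a i)) = (if \<forall>i\<in>I. even (a i) then 2 ^ card I else 0)"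
proof -
  have "(\<Sum>Y\<in>Pow I. (-1 :: int) ^ (\<Sum>i\<in>Y. a i)) = (\<Prod>i\<in>I. (-1) ^ a i + 1)"
    by (subst prod_add[OF assms]) (simp add: power_sum)
  also have "\<dots> = (if \<forall>i\<in>I. even (a i) then 2 ^ card I else 0)"
  proof (cases "\<forall>i\<in>I. even (a i)")
    case True
    thus ?thesis by simp
  next
    case False
    then obtain i where "i \<in> I" "odd (a i)" by auto
    hence "\<exists>i\<in>I. (-1 :: int) ^ a i + 1 = 0" by (intro bexI[of _ i]) auto
    thus ?thesis using assms False by (simp only: prod_zero_iff if_False)
  qed
  finally show ?thesis .
qed

text \<open>
  A matrix and its transpose have the same rank.  Over the field with two elements this is an
  identity between the sizes of the two kernels, which the double sum of the characters
  \<open>(-1)\<^bsup>y\<^sup>T m z\<^esup>\<close> shows directly: summing over \<open>y\<close> first leaves the kernel of \<open>m\<close>, summing over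
  \<open>z\<close> first the kernel of the transpose.
\<close>

lemma card_kernel_transpose:
  fixes m :: "'i \<Rightarrow> 'j \<Rightarrow> nat"
  assumes I: "finite I" and J: "finite J"
  shows "card {Z \<in> Pow J. \<forall>i\<in>I. even (\<Sum>j\<in>Z. m i j)} * 2 ^ card I
       = card {Y \<in> Pow I. \<forall>j\<in>J. even (\<Sum>i\<in>Y. m i j)} * 2 ^ card J"
proof -
  have "int (card {Z \<in> Pow J. \<forall>i\<in>I. even (\<Sum>j\<in>Z. m i j)} * 2 ^ card I)
      = (\<Sum>Z\<in>Pow J. if \<forall>i\<in>I. even (\<Sum>j\<in>Z. m i j) then 2 ^ card I else 0)"
    using J by (subst sum.inter_filter[symmetric]) auto
  also have "\<dots> = (\<Sum>Z\<in>Pow J. \<Sum>Y\<in>Pow I. (-1) ^ (\<Sum>i\<in>Y. \<Sum>j\<in>Z. m i j))"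
    by (simp add: character_sum[OF I])
  also have "\<dots> = (\<Sum>Y\<in>Pow I. \<Sum>Z\<in>Pow J. (-1) ^ (\<Sum>j\<in>Z. \<Sum>i\<in>Y. m i j))"
    by (subst sum.swap, subst (2) sum.swap) simp
  also have "\<dots> = (\<Sum>Y\<in>Pow I. if \<forall>j\<in>J. even (\<Sum>i\<in>Y. m i j) then 2 ^ card J else 0)"
    by (simp add: character_sum[OF J])
  also have "\<dots> = int (card {Y \<in> Pow I. \<forall>j\<in>J. even (\<Sum>i\<in>Y. m i j)} * 2 ^ card J)"
    using I by (subst sum.inter_filter[symmetric]) auto
  finally show ?thesis by (simp only: of_nat_eq_iff)
qed

text \<open>
  With indicator functions modulo 2 in mind, symmetric difference is addition and \<open>f\<close> is linear; every
  fibre of \<open>f\<close> is a translate of its kernel.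
\<close>

lemma card_kernel_image:
  assumes fin: "finite \<F>" and cl: "\<And>U V. U \<in> \<F> \<Longrightarrow> V \<in> \<F> \<Longrightarrow> sym_diff U V \<in> \<F>"
    and add: "\<And>U V. U \<in> \<F> \<Longrightarrow> V \<in> \<F> \<Longrightarrow> f (sym_diff U V) = sym_diff (f U) (f V)"
  shows "card \<F> = card (f ` \<F>) * card {U \<in> \<F>. f U = {}}"
proof -
  have "card {U \<in> \<F>. f U = y} = card {U \<in> \<F>. f U = {}}" if y: "y \<in> f ` \<F>" for y
  proof -
    obtain V where V: "V \<in> \<F>" "y = f V" using y by blast
    have invol: "sym_diff (sym_diff U V) V = U" for U by blast
    have "bij_betw (\<lambda>U. sym_diff U V) {U \<in> \<F>. f U = y} {U \<in> \<F>. f U = {}}"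
    proof (rule bij_betw_byWitness[where f' = "\<lambda>U. sym_diff U V"])
      show "(\<lambda>U. sym_diff U V) ` {U \<in> \<F>. f U = y} \<subseteq> {U \<in> \<F>. f U = {}}"
        using cl add V by auto
      show "(\<lambda>U. sym_diff U V) ` {U \<in> \<F>. f U = {}} \<subseteq> {U \<in> \<F>. f U = y}"
        using cl add V by auto
    qed (use invol in auto)
    thus ?thesis by (rule bij_betw_same_card)
  qed
  hence "(\<Sum>y\<in>f ` \<F>. \<Sum>x\<in>{x \<in> \<F>. f x = y}. 1) = card (f ` \<F>) * card {U \<in> \<F>. f U = {}}"
    by simp
  thus ?thesis using sum.image_gen[OF fin, of "\<lambda>_. 1::nat" f] by simp
qed

section \<open>The checkerboard colouring\<close>

lemma less_4_iff: "(j::nat) < 4 \<longleftrightarrow> j = 0 \<or> j = 1 \<or> j = 2 \<or> j = 3"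
  by auto

lemma all_less_4: "(\<forall>j<4. P (j::nat)) \<longleftrightarrow> P 0 \<and> P 1 \<and> P 2 \<and> P 3"
  by (auto simp: less_4_iff)

lemma length_ends [simp]: "length (ends c) = 4"
  by (simp add: ends_def)

locale planar_diagram =
  fixes D :: diagram
  assumes link_diagram: "link_diagram D"
begin

abbreviation n :: nat where "n \<equiv> length (crossings D)"

abbreviation end_at :: "nat \<Rightarrow> nat \<Rightarrow> arc \<times> bool" where
  "end_at r j \<equiv> ends (crossings D ! r) ! j"

abbreviation arc_at :: "nat \<Rightarrow> nat \<Rightarrow> arc" where
  "arc_at r j \<equiv> slot (crossings D ! r) j"

abbreviation other_side :: "arc \<times> bool \<Rightarrow> arc \<times> bool" where
  "other_side x \<equiv> (fst x, \<not> snd x)"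

lemma finite_arcs: "finite (arcs D)" and finite_loops: "finite (loops D)"
  using link_diagram by (auto simp: link_diagram_def arcs_def)

lemma arcs_eq: "arcs D = set (in_arcs D) \<union> loops D"
  and loops_disjoint: "set (in_arcs D) \<inter> loops D = {}"
  using link_diagram by (auto simp: link_diagram_def arcs_def)

text \<open>
  The incoming ends at the crossings enumerate the arcs other than loops without repetition, and so
  do the outgoing ends.  An end is thus determined by its arc and its direction.
\<close>

lemma bij_betw_ends:
  "bij_betw (\<lambda>(r, j). end_at r j) ({..<n} \<times> {..<4}) (set (in_arcs D) \<times> UNIV)"
proof -
  let ?E = "concat (map ends (crossings D))"
  have "mset (concat (map ends cs)) =
      mset (map (\<lambda>a. (a, False)) (concat (map (\<lambda>c. [under_in c, over_in c]) cs)) @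
            map (\<lambda>a. (a, True)) (concat (map (\<lambda>c. [under_out c, over_out c]) cs)))" for cs
    by (induction cs) (auto simp: ends_def)
  from this[of "crossings D"]
  have m: "mset ?E = mset (map (\<lambda>a. (a, False)) (in_arcs D) @ map (\<lambda>a. (a, True)) (out_arcs D))"
    by (simp add: in_arcs_def out_arcs_def)
  have "distinct (map (\<lambda>a. (a, False)) (in_arcs D) @ map (\<lambda>a. (a, True)) (out_arcs D))"
    using link_diagram by (auto simp: link_diagram_def distinct_map inj_on_def)
  hence dist: "distinct ?E" using m mset_eq_imp_distinct_iff by blast
  have "set ?E = set (map (\<lambda>a. (a, False)) (in_arcs D) @ map (\<lambda>a. (a, True)) (out_arcs D))"
    using m by (rule mset_eq_setD)
  also have "\<dots> = set (in_arcs D) \<times> UNIV"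
    using link_diagram by (auto simp: link_diagram_def UNIV_bool image_iff)
  finally have set: "set ?E = set (in_arcs D) \<times> UNIV" .
  have rm: "removeAll [] (map ends (crossings D)) = map ends (crossings D)"
    by (rule removeAll_id) (auto simp: ends_def)
  have d1: "distinct (map ends (crossings D))"
    and d2: "\<And>r. r < n \<Longrightarrow> distinct (ends (crossings D ! r))"
    and d3: "\<And>c c'. c \<in> set (crossings D) \<Longrightarrow> c' \<in> set (crossings D) \<Longrightarrow> ends c \<noteq> ends c' \<Longrightarrow>
       set (ends c) \<inter> set (ends c') = {}"
    using dist unfolding distinct_concat_iff rm by auto
  show ?thesis
  proof (rule bij_betwI')
    fix x y :: "nat \<times> nat"
    assume "x \<in> {..<n} \<times> {..<4}" "y \<in> {..<n} \<times> {..<4}"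
    then obtain r j s k where rj: "x = (r, j)" "r < n" "j < 4" and sk: "y = (s, k)" "s < n" "k < 4"
      by auto
    have "r = s \<and> j = k" if eq: "end_at r j = end_at s k"
    proof -
      have "end_at r j \<in> set (ends (crossings D ! r)) \<inter> set (ends (crossings D ! s))"
        using rj sk eq by (metis IntI length_ends nth_mem)
      hence "ends (crossings D ! r) = ends (crossings D ! s)"
        using d3 rj sk by (metis empty_iff nth_mem)
      hence "r = s" using d1 rj sk by (simp add: distinct_conv_nth) metis
      moreover from this have "j = k" using d2[of r] eq rj sk by (simp add: nth_eq_iff_index_eq)
      ultimately show ?thesis by simp
    qed
    thus "((case x of (r, j) \<Rightarrow> end_at r j) = (case y of (r, j) \<Rightarrow> end_at r j)) = (x = y)"
      using rj sk by auto
  next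
    fix x :: "nat \<times> nat"
    assume "x \<in> {..<n} \<times> {..<4}"
    thus "(case x of (r, j) \<Rightarrow> end_at r j) \<in> set (in_arcs D) \<times> UNIV"
      unfolding set[symmetric] by (auto intro!: bexI[of _ "crossings D ! fst x"])
  next
    fix y :: "arc \<times> bool" assume "y \<in> set (in_arcs D) \<times> UNIV"
    then obtain c where "c \<in> set (crossings D)" "y \<in> set (ends c)"
      unfolding set[symmetric] by auto
    then obtain r j where "r < n" "j < 4" "y = end_at r j"
      by (metis in_set_conv_nth length_ends)
    thus "\<exists>x\<in>{..<n} \<times> {..<4}. y = (case x of (r, j) \<Rightarrow> end_at r j)" by force
  qed
qed

lemma end_at_inj: "end_at r j = end_at s k \<Longrightarrow> r < n \<Longrightarrow> s < n \<Longrightarrow> j < 4 \<Longrightarrow> k < 4 \<Longrightarrow> r = s \<and> j = k"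
  using bij_betw_imp_inj_on[OF bij_betw_ends] by (force simp: inj_on_def)

lemma end_at_in: "r < n \<Longrightarrow> j < 4 \<Longrightarrow> end_at r j \<in> set (in_arcs D) \<times> UNIV"
  using bij_betwE[OF bij_betw_ends] by force

lemma arc_at_in: "r < n \<Longrightarrow> j < 4 \<Longrightarrow> arc_at r j \<in> set (in_arcs D)"
  using end_at_in[of r j] by (auto simp: slot_def)

lemma arc_at_in_arcs: "r < n \<Longrightarrow> j < 4 \<Longrightarrow> arc_at r j \<in> arcs D"
  using arc_at_in by (simp add: arcs_eq)

lemma obtain_end:
  assumes "a \<in> set (in_arcs D)"
  obtains r j where "r < n" "j < 4" "end_at r j = (a, b)"
proof -
  have "(a, b) \<in> (\<lambda>(r, j). end_at r j) ` ({..<n} \<times> {..<4})"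
    using bij_betw_imp_surj_on[OF bij_betw_ends] assms by simp
  thus ?thesis using that by auto
qed

lemma share_crossing_iff:
  "share_crossing D a b \<longleftrightarrow> (\<exists>r<n. \<exists>i<4. \<exists>j<4. a = arc_at r i \<and> b = arc_at r j)"
  unfolding share_crossing_def by (metis in_set_conv_nth)

lemma corner_iff:
  "corner D x y \<longleftrightarrow> (\<exists>r<n. \<exists>j<4. x = end_at r j \<and> y = other_side (end_at r ((j + 1) mod 4)))"
  unfolding corner_def by (metis in_set_conv_nth)

lemma share_crossing_arcs: "share_crossing D a b \<Longrightarrow> a \<in> arcs D \<and> b \<in> arcs D"
  using arc_at_in_arcs by (auto simp: share_crossing_iff)

lemma corner_sides:
  assumes "corner D x y"
  shows "x \<in> arcs D \<times> UNIV \<and> y \<in> arcs D \<times> UNIV"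
proof -
  obtain r j where rj: "r < n" "j < 4" "x = end_at r j" "y = other_side (end_at r ((j + 1) mod 4))"
    using assms by (auto simp: corner_iff)
  have "fst (end_at r i) \<in> arcs D" if "i < 4" for i
    using arc_at_in_arcs[OF rj(1) that] by (simp add: slot_def)
  thus ?thesis using rj by (simp add: mem_Times_iff)
qed

definition checkerboard :: "(arc \<times> bool) set \<Rightarrow> bool" where
  "checkerboard W \<longleftrightarrow> W \<in> saturated (arcs D \<times> UNIV) (corner D) \<and>
     (\<forall>a\<in>arcs D. (a, True) \<in> W \<longleftrightarrow> (a, False) \<notin> W)"

text \<open>
  This is the cellular boundary map modulo 2 from faces to arcs, where a set of faces is given as the
  set of the sides of arcs that lie in these faces.
\<close>

definition boundary :: "(arc \<times> bool) set \<Rightarrow> arc set" where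
  "boundary U = {a \<in> arcs D. (a, True) \<in> U \<longleftrightarrow> (a, False) \<notin> U}"

definition incidence :: "nat \<Rightarrow> arc \<Rightarrow> nat" where
  "incidence r a = card {j. j < 4 \<and> arc_at r j = a}"

text \<open>
  The kernel of the boundary map modulo 2 from arcs to crossings, and the kernel of its transpose.
\<close>

definition arc_cycles :: "arc set set" where
  "arc_cycles = {Z \<in> Pow (arcs D). \<forall>r\<in>{..<n}. even (\<Sum>a\<in>Z. incidence r a)}"

definition vertex_cocycles :: "nat set set" where
  "vertex_cocycles = {Y \<in> Pow {..<n}. \<forall>a\<in>arcs D. even (\<Sum>r\<in>Y. incidence r a)}"

lemma sum_incidence:
  assumes "finite Z"
  shows "(\<Sum>a\<in>Z. incidence r a) = card {j. j < 4 \<and> arc_at r j \<in> Z}"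
proof -
  have "(\<Sum>a\<in>Z. incidence r a) = card (\<Union>a\<in>Z. {j. j < 4 \<and> arc_at r j = a})"
    unfolding incidence_def by (subst card_UN_disjoint) (use assms in auto)
  also have "(\<Union>a\<in>Z. {j. j < 4 \<and> arc_at r j = a}) = {j. j < 4 \<and> arc_at r j \<in> Z}" by auto
  finally show ?thesis .
qed

lemma corner_step:
  assumes "U \<in> saturated (arcs D \<times> UNIV) (corner D)" "r < n" "j < 4"
  shows "end_at r j \<in> U \<longleftrightarrow> other_side (end_at r ((j + 1) mod 4)) \<in> U"
proof -
  have "corner D (end_at r j) (other_side (end_at r ((j + 1) mod 4)))"
    using assms(2,3) by (auto simp: corner_iff)
  thus ?thesis using assms(1) unfolding saturated_def by blast
qed

lemma boundary_iff: "r < n \<Longrightarrow> j < 4 \<Longrightarrow>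
    arc_at r j \<in> boundary U \<longleftrightarrow> (end_at r j \<in> U \<longleftrightarrow> other_side (end_at r j) \<notin> U)"
  using arc_at_in_arcs[of r j] unfolding boundary_def slot_def
  by (cases "end_at r j"; cases "snd (end_at r j)") auto

text \<open>
  Around a crossing, each end separates the corner before it from the corner after it, and going
  once around the number of changes between corners inside and outside of \<open>U\<close> is even.
\<close>

lemma boundary_is_cycle:
  assumes U: "U \<in> saturated (arcs D \<times> UNIV) (corner D)"
  shows "boundary U \<in> arc_cycles"
proof -
  have sub: "boundary U \<subseteq> arcs D" by (auto simp: boundary_def)
  have "even (card {j. j < 4 \<and> arc_at r j \<in> boundary U})" if r: "r < n" for r
  proof -
    define u where "u j = (end_at r j \<in> U)" for j
    define b where "b j = (arc_at r j \<in> boundary U)" for j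
    have b: "b j \<longleftrightarrow> (u j \<noteq> u ((j + 3) mod 4))" if "j < 4" for j
    proof -
      have "((j + 3) mod 4 + 1) mod 4 = j" using that by (auto simp: less_4_iff)
      hence "u ((j + 3) mod 4) \<longleftrightarrow> other_side (end_at r j) \<in> U"
        using corner_step[OF U r, of "(j + 3) mod 4"] by (simp add: u_def)
      thus ?thesis using boundary_iff[OF r that] unfolding b_def u_def by blast
    qed
    have "{j. j < 4 \<and> b j} = set (filter b [0, 1, 2, 3])"
    proof (rule Set.set_eqI)
      show "j \<in> {j. j < 4 \<and> b j} \<longleftrightarrow> j \<in> set (filter b [0, 1, 2, 3])" for j
        using less_4_iff[of j] by (cases "b j") auto
    qed
    hence "card {j. j < 4 \<and> b j} = length (filter b [0, 1, 2, 3])"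
      using distinct_card[of "filter b [0, 1, 2, 3]"] by simp
    moreover have "b 0 = (u 0 \<noteq> u 3)" "b 1 = (u 1 \<noteq> u 0)" "b 2 = (u 2 \<noteq> u 1)" "b 3 = (u 3 \<noteq> u 2)"
      using b[of 0] b[of 1] b[of 2] b[of 3] by simp_all
    ultimately have "even (card {j. j < 4 \<and> b j})" by simp
    thus ?thesis by (simp only: b_def)
  qed
  thus ?thesis using sub finite_subset[OF sub finite_arcs] by (auto simp: arc_cycles_def sum_incidence)
qed

text \<open>
  A set of faces without boundary contains both sides or neither side of an arc.  Turning around a
  crossing, one sees that all arcs of a piece behave in the same way.
\<close>

lemma card_closed_faces:
  "card {U \<in> saturated (arcs D \<times> UNIV) (corner D). boundary U = {}} \<le> 2 ^ card (pieces D)"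
proof -
  let ?K = "{U \<in> saturated (arcs D \<times> UNIV) (corner D). boundary U = {}}"
  have side: "x \<in> U \<longleftrightarrow> (fst x, True) \<in> U" if "U \<in> ?K" for U x
    using that by (cases x; cases "snd x") (auto simp: boundary_def saturated_def)
  have "card ?K \<le> card (saturated (arcs D) (share_crossing D))"
  proof (rule card_inj_on_le[where f = "\<lambda>U. {a. (a, True) \<in> U}"])
    show "inj_on (\<lambda>U. {a. (a, True) \<in> U}) ?K"
    proof (rule inj_onI)
      fix U V assume U: "U \<in> ?K" and V: "V \<in> ?K" and eq: "{a. (a, True) \<in> U} = {a. (a, True) \<in> V}"
      have "x \<in> U \<longleftrightarrow> x \<in> V" for x using side[OF U, of x] side[OF V, of x] eq by blast
      thus "U = V" by blast
    qed
    show "(\<lambda>U. {a. (a, True) \<in> U}) ` ?K \<subseteq> saturated (arcs D) (share_crossing D)"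
    proof safe
      fix U assume K: "U \<in> saturated (arcs D \<times> UNIV) (corner D)" "boundary U = {}"
      have step: "(arc_at r j, True) \<in> U \<longleftrightarrow> (arc_at r ((j + 1) mod 4), True) \<in> U"
        if "r < n" "j < 4" for r j
        using corner_step[OF K(1) that] side[of U "end_at r j"]
          side[of U "other_side (end_at r ((j + 1) mod 4))"] K by (simp add: slot_def)
      have "(arc_at r j, True) \<in> U \<longleftrightarrow> (arc_at r 0, True) \<in> U" if "r < n" "j < 4" for r j
      proof -
        have "(arc_at r 0, True) \<in> U \<longleftrightarrow> (arc_at r 1, True) \<in> U" using step[OF that(1), of 0] by simp
        moreover have "(arc_at r 1, True) \<in> U \<longleftrightarrow> (arc_at r 2, True) \<in> U"
          using step[OF that(1), of 1] by (simp add: numeral_2_eq_2)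
        moreover have "(arc_at r 2, True) \<in> U \<longleftrightarrow> (arc_at r 3, True) \<in> U"
          using step[OF that(1), of 2] by simp
        ultimately show ?thesis using that(2) unfolding less_4_iff by blast
      qed
      thus "{a. (a, True) \<in> U} \<in> saturated (arcs D) (share_crossing D)"
        using K(1) unfolding saturated_def share_crossing_iff by blast
    qed
  qed (use finite_saturated finite_arcs in auto)
  also have "\<dots> = 2 ^ card (pieces D)"
    unfolding pieces_def using card_saturated[OF finite_arcs share_crossing_arcs] by blast
  finally show ?thesis .
qed

text \<open>
  All incidences of an arc come from its two ends.  If only one of them lay at a crossing in \<open>Y\<close>, the
  arc would be incident to \<open>Y\<close> exactly once.
\<close>

lemma vertex_cocycle_ends:
  assumes Y: "Y \<in> vertex_cocycles" and r: "r < n" "i < 4" and s: "s < n" "j < 4"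
    and eq: "arc_at r i = arc_at s j" and rY: "r \<in> Y"
  shows "s \<in> Y"
proof (rule ccontr)
  assume sY: "s \<notin> Y"
  have finY: "finite Y" and Yn: "Y \<subseteq> {..<n}"
    using Y finite_subset by (auto simp: vertex_cocycles_def)
  have "(\<Sum>q\<in>Y. incidence q (arc_at r i)) = card (SIGMA q:Y. {k. k < 4 \<and> arc_at q k = arc_at r i})"
    unfolding incidence_def using finY by (subst card_SigmaI) auto
  also have "(SIGMA q:Y. {k. k < 4 \<and> arc_at q k = arc_at r i}) = {(r, i)}"
  proof safe
    fix q k assume q: "q \<in> Y" "k < 4" "arc_at q k = arc_at r i"
    hence qn: "q < n" using Yn by auto
    have "end_at r i \<noteq> end_at s j" using end_at_inj r s rY sY by metis
    hence "end_at q k = end_at r i \<or> end_at q k = end_at s j"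
      using q(3) eq by (auto simp: slot_def prod_eq_iff)
    thus "q = r" "k = i"
      using end_at_inj qn q(1,2) r s sY by metis+
  qed (use r rY in auto)
  finally have "(\<Sum>q\<in>Y. incidence q (arc_at r i)) = 1" by simp
  moreover have "even (\<Sum>q\<in>Y. incidence q (arc_at r i))"
    using Y arc_at_in_arcs[OF r] by (auto simp: vertex_cocycles_def)
  ultimately show False by simp
qed

text \<open>
  A cocycle is constant on the pieces with crossings.  The remaining pieces are the loops, where a
  value can be chosen freely.
\<close>

lemma card_vertex_cocycles: "card vertex_cocycles * 2 ^ card (loops D) \<le> 2 ^ card (pieces D)"
proof -
  let ?f = "\<lambda>(Y, G). {arc_at r j |r j. r \<in> Y \<and> j < 4} \<union> G"
  have Yn: "Y \<subseteq> {..<n}" if "Y \<in> vertex_cocycles" for Y using that by (auto simp: vertex_cocycles_def)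
  have iff: "arc_at r i \<in> ?f (Y, G) \<longleftrightarrow> r \<in> Y"
    if "Y \<in> vertex_cocycles" "G \<subseteq> loops D" "r < n" "i < 4" for Y G r i
  proof
    assume "arc_at r i \<in> ?f (Y, G)"
    moreover have "arc_at r i \<notin> G" using that(2) arc_at_in[OF that(3,4)] loops_disjoint by blast
    ultimately obtain s j where "arc_at r i = arc_at s j" "s \<in> Y" "j < 4" by auto
    thus "r \<in> Y"
      using vertex_cocycle_ends[OF that(1) _ _ that(3,4), of s j] Yn[OF that(1)] by auto
  next
    assume "r \<in> Y"
    thus "arc_at r i \<in> ?f (Y, G)" using that(4) by auto
  qed
  have fin: "finite vertex_cocycles" by (simp add: vertex_cocycles_def)
  have "card (vertex_cocycles \<times> Pow (loops D)) \<le> card (saturated (arcs D) (share_crossing D))"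
  proof (rule card_inj_on_le)
    show "inj_on ?f (vertex_cocycles \<times> Pow (loops D))"
    proof (rule inj_onI)
      fix x y assume x: "x \<in> vertex_cocycles \<times> Pow (loops D)" and y: "y \<in> vertex_cocycles \<times> Pow (loops D)"
        and eq: "?f x = ?f y"
      obtain Y G Y' G' where xy: "x = (Y, G)" "y = (Y', G')" by fastforce
      have Y: "Y \<in> vertex_cocycles" "G \<subseteq> loops D" "Y' \<in> vertex_cocycles" "G' \<subseteq> loops D"
        using x y xy by auto
      have "r \<in> Y \<longleftrightarrow> r \<in> Y'" if "r < n" for r
      proof -
        have "arc_at r 0 \<in> ?f (Y, G) \<longleftrightarrow> r \<in> Y" by (rule iff[OF Y(1,2) that]) simp
        moreover have "arc_at r 0 \<in> ?f (Y', G') \<longleftrightarrow> r \<in> Y'" by (rule iff[OF Y(3,4) that]) simp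
        ultimately show ?thesis using eq unfolding xy by argo
      qed
      hence "Y = Y'" using Yn[OF Y(1)] Yn[OF Y(3)] by blast
      moreover have "?f (Y, G) \<inter> loops D = G" if "Y \<in> vertex_cocycles" "G \<subseteq> loops D" for Y G
      proof -
        have "arc_at r j \<notin> loops D" if "r \<in> Y" "j < 4" for r j
          using arc_at_in[of r j] that Yn[OF \<open>Y \<in> vertex_cocycles\<close>] loops_disjoint by blast
        thus ?thesis using that(2) by auto
      qed
      from this[OF Y(1,2)] this[OF Y(3,4)] have "?f x \<inter> loops D = G" "?f y \<inter> loops D = G'"
        by (simp_all only: xy)
      hence "G = G'" unfolding eq by simp
      ultimately show "x = y" using xy by simp
    qed
    show "?f ` (vertex_cocycles \<times> Pow (loops D)) \<subseteq> saturated (arcs D) (share_crossing D)"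
    proof
      fix U assume "U \<in> ?f ` (vertex_cocycles \<times> Pow (loops D))"
      then obtain Y G where U: "U = ?f (Y, G)" and YG: "Y \<in> vertex_cocycles" "G \<subseteq> loops D" by blast
      have "U \<subseteq> arcs D" using Yn[OF YG(1)] YG(2) arc_at_in_arcs unfolding U by (auto simp: arcs_eq)
      moreover have "arc_at r i \<in> U \<longleftrightarrow> arc_at r j \<in> U" if "r < n" "i < 4" "j < 4" for r i j
        using iff[OF YG] that unfolding U by simp
      ultimately show "U \<in> saturated (arcs D) (share_crossing D)"
        unfolding saturated_def share_crossing_iff by blast
    qed
  qed (use finite_saturated finite_arcs in auto)
  also have "\<dots> = 2 ^ card (pieces D)"
    unfolding pieces_def using card_saturated[OF finite_arcs share_crossing_arcs] by blast
  finally show ?thesis by (simp add: card_cartesian_product card_Pow finite_loops)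
qed

text \<open>
  The set of all arcs is a cycle modulo 2, as four ends meet at every crossing.  By Euler's
  formula every cycle is the boundary of a set of faces: the two preceding estimates give as
  many boundaries as there are cycles.
\<close>

theorem checkerboard_exists: "\<exists>W. checkerboard W"
proof -
  let ?S = "saturated (arcs D \<times> UNIV) (corner D)"
  let ?F = "card (faces D)" and ?p = "card (pieces D)" and ?l = "card (loops D)"
  let ?e = "card (set (in_arcs D))"
  have finS: "finite ?S"
    by (rule finite_saturated[OF finite_cartesian_product[OF finite_arcs finite_UNIV]])
  have sub: "boundary ` ?S \<subseteq> arc_cycles" using boundary_is_cycle by auto
  have fin: "finite arc_cycles" using finite_arcs by (simp add: arc_cycles_def)
  have "2 ^ ?F = card ?S"
    unfolding faces_def using card_saturated[of "arcs D \<times> UNIV" "corner D"] finite_arcs corner_sides by simp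
  also have "\<dots> = card (boundary ` ?S) * card {U \<in> ?S. boundary U = {}}"
  proof (rule card_kernel_image[OF finS])
    fix U V assume "U \<in> ?S" "V \<in> ?S"
    thus "sym_diff U V \<in> ?S" by (rule saturated_sym_diff)
    show "boundary (sym_diff U V) = sym_diff (boundary U) (boundary V)" by (auto simp: boundary_def)
  qed
  also have "\<dots> \<le> card (boundary ` ?S) * 2 ^ ?p" using card_closed_faces by simp
  finally have B: "2 ^ ?F \<le> card (boundary ` ?S) * 2 ^ ?p" .
  have "card (arcs D) = ?e + ?l"
    unfolding arcs_eq using loops_disjoint finite_loops by (simp add: card_Un_disjoint)
  moreover have "card arc_cycles * 2 ^ n = card vertex_cocycles * 2 ^ card (arcs D)"
    using card_kernel_transpose[OF finite_lessThan finite_arcs, of n incidence]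
    by (simp add: arc_cycles_def vertex_cocycles_def)
  ultimately have "card arc_cycles * 2 ^ n = card vertex_cocycles * 2 ^ ?l * 2 ^ ?e"
    by (simp add: power_add)
  also have "\<dots> \<le> 2 ^ ?p * 2 ^ ?e" using card_vertex_cocycles by (rule mult_right_mono) simp
  finally have Z: "card arc_cycles * 2 ^ n \<le> 2 ^ ?p * 2 ^ ?e" .
  have "int n - int ?e + int ?F = 2 * int ?p" using link_diagram unfolding link_diagram_def by blast
  hence euler: "n + ?F = 2 * ?p + ?e" by linarith
  \<comment> \<open>There are at least \<open>2\<^bsup>F - p\<^esup>\<close> boundaries and at most \<open>2\<^bsup>p + e - n\<^esup>\<close> cycles.\<close>
  have "card arc_cycles * 2 ^ (n + ?F) = (card arc_cycles * 2 ^ n) * 2 ^ ?F" by (simp add: power_add)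
  also have "\<dots> \<le> (2 ^ ?p * 2 ^ ?e) * (card (boundary ` ?S) * 2 ^ ?p)"
    by (rule mult_mono[OF Z B]) auto
  also have "\<dots> = card (boundary ` ?S) * 2 ^ (n + ?F)"
    unfolding euler by (simp add: power_add mult_2)
  finally have "card arc_cycles \<le> card (boundary ` ?S)" by simp
  hence "boundary ` ?S = arc_cycles" using sub fin card_seteq by blast
  moreover have "arcs D \<in> arc_cycles"
  proof -
    have "{j. j < 4 \<and> arc_at r j \<in> arcs D} = {..<4}" if "r < n" for r
      using that arc_at_in_arcs by auto
    thus ?thesis using finite_arcs by (simp add: arc_cycles_def sum_incidence)
  qed
  ultimately obtain W where W: "W \<in> ?S" "boundary W = arcs D" by (metis imageE)
  hence "checkerboard W" by (auto simp: checkerboard_def boundary_def)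
  thus ?thesis ..
qed

end

section \<open>Smoothings as permutations\<close>

lemma not_equivclp_closed:
  assumes "inj f" "finite T" "f ` T \<subseteq> T" "p \<in> T" "q \<notin> T"
  shows "\<not> equivclp (\<lambda>a b. b = f a) p q"
proof -
  have "f ` T = T" using assms by (meson endo_inj_surj inj_on_subset subset_UNIV)
  hence "T \<in> saturated UNIV (\<lambda>a b. b = f a)"
    using assms(1) by (auto simp: saturated_def dest: injD)
  thus ?thesis using saturated_equivclp assms(4,5) by metis
qed

text \<open>
  Composing a permutation with a transposition \<open>(p q)\<close> merges the cycles of \<open>p\<close> and \<open>q\<close> or
  splits their common cycle, since it redirects the first return from \<open>p\<close> to \<open>{p, q}\<close>.
\<close>

lemma transpose_toggles_connection:
  assumes f: "f permutes S" "finite S" and pq: "p \<noteq> q"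
  shows "equivclp (\<lambda>a b. b = f a) p q \<longleftrightarrow> \<not> equivclp (\<lambda>a b. b = transpose p q (f a)) p q"
proof -
  define g where "g = transpose p q \<circ> f"
  have injf: "inj f" using permutes_inj[OF f(1)] .
  have injg: "inj g" unfolding g_def using injf by (simp add: inj_compose)
  have "permutation f" using f permutation_permutes by blast
  hence "p \<in> orbit f p" by (rule permutation_self_in_orbit)
  then obtain m where m: "0 < m \<and> (f ^^ m) p \<in> {p, q}" by (auto simp: orbit_altdef) metis
  define k where "k = (LEAST k. 0 < k \<and> (f ^^ k) p \<in> {p, q})"
  have k: "0 < k" "(f ^^ k) p \<in> {p, q}" using LeastI[of "\<lambda>k. 0 < k \<and> (f ^^ k) p \<in> {p, q}", OF m] k_def by auto
  have least: "(f ^^ j) p \<notin> {p, q}" if "0 < j" "j < k" for j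
    using not_less_Least[of j "\<lambda>k. 0 < k \<and> (f ^^ k) p \<in> {p, q}"] that k_def by auto
  \<comment> \<open>The cycle of \<open>p\<close> up to the first return to \<open>{p, q}\<close>, a cycle of \<open>f\<close> or of \<open>g\<close>.\<close>
  define T where "T = (\<lambda>j. (f ^^ j) p) ` {..<k}"
  have finT: "finite T" and pT: "p \<in> T"
    using k(1) by (auto simp: T_def intro!: image_eqI[of _ _ 0])
  have qT: "q \<notin> T"
  proof
    assume "q \<in> T"
    then obtain j where j: "j < k" "q = (f ^^ j) p" by (auto simp: T_def)
    thus False using least[of j] pq by (cases "j = 0") auto
  qed
  have step: "g ((f ^^ j) p) = (f ^^ Suc j) p" if "Suc j < k" for j
    using least[of "Suc j"] that by (simp add: g_def transpose_eq_iff)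
  have last: "f ((f ^^ (k - 1)) p) = (f ^^ k) p" using k(1) by (cases k) auto
  have fpath: "equivclp (\<lambda>a b. b = f a) p ((f ^^ j) p)" for j
    by (induction j) (auto intro: equivclp_refl equivclp_trans r_into_equivclp)
  have gpath: "equivclp (\<lambda>a b. b = g a) p ((f ^^ j) p)" if "j < k" for j
    using that
  proof (induction j)
    case 0
    thus ?case by (simp add: equivclp_refl)
  next
    case (Suc j)
    thus ?case using r_into_equivclp[of "\<lambda>a b. b = g a"] step by (metis equivclp_trans Suc_lessD)
  qed
  have "equivclp (\<lambda>a b. b = f a) p q \<longleftrightarrow> \<not> equivclp (\<lambda>a b. b = g a) p q"
  proof (cases "(f ^^ k) p = p")
    case True
    have "f ` T \<subseteq> T"
    proof safe
      fix x assume "x \<in> T"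
      then obtain j where j: "j < k" "x = (f ^^ j) p" by (auto simp: T_def)
      show "f x \<in> T"
      proof (cases "Suc j = k")
        case True
        thus ?thesis using j \<open>(f ^^ k) p = p\<close> pT by auto
      next
        case False
        thus ?thesis using j by (auto simp: T_def intro!: image_eqI[of _ _ "Suc j"])
      qed
    qed
    hence "\<not> equivclp (\<lambda>a b. b = f a) p q" using not_equivclp_closed injf finT pT qT by metis
    moreover have "equivclp (\<lambda>a b. b = g a) ((f ^^ (k - 1)) p) q"
      using last True by (intro r_into_equivclp) (simp add: g_def)
    hence "equivclp (\<lambda>a b. b = g a) p q" using gpath[of "k - 1"] k(1) equivclp_trans by force
    ultimately show ?thesis by simp
  next
    case False
    hence q: "(f ^^ k) p = q" using k(2) by simp
    have "g ` T \<subseteq> T"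
    proof safe
      fix x assume "x \<in> T"
      then obtain j where j: "j < k" "x = (f ^^ j) p" by (auto simp: T_def)
      show "g x \<in> T"
      proof (cases "Suc j = k")
        case True
        hence "f x = q" using j q by auto
        thus ?thesis using pT by (simp add: g_def)
      next
        case False
        thus ?thesis using j step[of j] by (auto simp: T_def intro!: image_eqI[of _ _ "Suc j"])
      qed
    qed
    hence "\<not> equivclp (\<lambda>a b. b = g a) p q" using not_equivclp_closed injg finT pT qT by metis
    thus ?thesis using fpath[of k] q by simp
  qed
  thus ?thesis by (simp add: g_def)
qed

text \<open>
  A path that starts in a class disjoint from \<open>H\<close> never reaches \<open>H\<close>, so that all its steps are available
  in both relations.
\<close>

lemma equivclp_class_unaffected:
  assumes "\<And>a b. R a b \<Longrightarrow> R' a b \<or> a \<in> H \<and> b \<in> H" "\<And>a b. R' a b \<Longrightarrow> R a b \<or> a \<in> H \<and> b \<in> H"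
    and dis: "{b. equivclp R x b} \<inter> H = {}"
  shows "{b. equivclp R x b} = {b. equivclp R' x b}"
proof -
  have "equivclp R x b \<Longrightarrow> equivclp R' x b" for b
  proof (induction rule: equivclp_induct)
    case base
    show ?case by (rule equivclp_refl)
  next
    case (step y z)
    hence "y \<notin> H" using dis by blast
    hence "R' y z \<or> R' z y" using step(2) assms(1) by blast
    thus ?case using step(3) by (meson equivclp_trans equivclp_sym r_into_equivclp)
  qed
  moreover have "equivclp R' x b \<Longrightarrow> equivclp R x b" for b
  proof (induction rule: equivclp_induct)
    case base
    show ?case by (rule equivclp_refl)
  next
    case (step y z)
    hence "y \<notin> H" using dis by blast
    hence "R y z \<or> R z y" using step(2) assms(2) by blast
    thus ?case using step(3) by (meson equivclp_trans equivclp_sym r_into_equivclp)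
  qed
  ultimately show ?thesis by blast
qed

text \<open>
  The position joined to the position \<open>j\<close> of a crossing by its 0-smoothing and by its
  1-smoothing.
\<close>

definition partner :: "bool \<Rightarrow> nat \<Rightarrow> nat" where
  "partner b j = (if b then 3 - j else if even j then j + 1 else j - 1)"

context planar_diagram
begin

lemma partner_less: "j < 4 \<Longrightarrow> partner b j < 4"
  and partner_partner: "j < 4 \<Longrightarrow> partner b (partner b j) = j"
  by (auto simp: partner_def less_4_iff)

lemma smoothing_arcs: "smoothing D \<alpha> a b \<Longrightarrow> a \<in> arcs D \<and> b \<in> arcs D"
  using arc_at_in_arcs by (auto simp: smoothing_def Let_def split: if_splits)

lemma smoothing_partner:
  assumes "r < n" "j < 4"
  shows "smoothing D \<alpha> (arc_at r j) (arc_at r (partner (\<alpha> ! r) j)) \<or>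
         smoothing D \<alpha> (arc_at r (partner (\<alpha> ! r) j)) (arc_at r j)"
proof -
  have *: "smoothing D \<alpha> a b"
    if "if \<alpha> ! r then (a, b) = (arc_at r 0, arc_at r 3) \<or> (a, b) = (arc_at r 1, arc_at r 2)
        else (a, b) = (arc_at r 0, arc_at r 1) \<or> (a, b) = (arc_at r 2, arc_at r 3)" for a b
    unfolding smoothing_def Let_def using assms(1) that by blast
  consider "j = 0" | "j = 1" | "j = 2" | "j = 3" using assms(2) less_4_iff by auto
  thus ?thesis
    by cases (cases "\<alpha> ! r"; simp add: * partner_def)+
qed

lemma smoothing_obtain_partner:
  assumes "smoothing D \<alpha> a b"
  obtains r j where "r < n" "j < 4" "a = arc_at r j" "b = arc_at r (partner (\<alpha> ! r) j)"
proof -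
  obtain r where r: "r < n" and s: "if \<alpha> ! r then (a, b) = (arc_at r 0, arc_at r 3) \<or> (a, b) = (arc_at r 1, arc_at r 2)
     else (a, b) = (arc_at r 0, arc_at r 1) \<or> (a, b) = (arc_at r 2, arc_at r 3)"
    using assms by (auto simp: smoothing_def Let_def)
  show thesis
    using s that[OF r, of 0] that[OF r, of 1] that[OF r, of 2] by (auto simp: partner_def split: if_splits)
qed

lemma circles_eq: "circles D \<alpha> = circle_of D \<alpha> ` arcs D"
  by (simp add: circles_def circle_of_def generated_classes_eq)

lemma circle_of_eq_iff: "circle_of D \<alpha> a = circle_of D \<alpha> b \<longleftrightarrow> equivclp (smoothing D \<alpha>) a b"
  unfolding circle_of_def by (rule equivclp_class_eq)

lemma in_circle_of: "b \<in> circle_of D \<alpha> a \<longleftrightarrow> circle_of D \<alpha> a = circle_of D \<alpha> b"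
  unfolding circle_of_eq_iff by (simp add: circle_of_def)

lemma circle_of_partner: "r < n \<Longrightarrow> j < 4 \<Longrightarrow>
    circle_of D \<alpha> (arc_at r (partner (\<alpha> ! r) j)) = circle_of D \<alpha> (arc_at r j)"
  unfolding circle_of_eq_iff using smoothing_partner equivclp_sym r_into_equivclp by metis

end

text \<open>
  Orient every arc such that the black faces of the checkerboard are on its left.  The four ends
  at a crossing are then alternately incoming and outgoing, so that the oriented arcs fit
  together along both smoothings, although these need not respect the orientation of the link.
  Hence the circles of a smoothing are the cycles of a permutation of the arcs.
\<close>

locale checkerboard_diagram = planar_diagram +
  fixes W :: "(arc \<times> bool) set"
  assumes checkerboard: "checkerboard W"
begin

lemma W_saturated: "W \<in> saturated (arcs D \<times> UNIV) (corner D)"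
  using checkerboard by (simp add: checkerboard_def)

lemma other_side_W: "fst x \<in> arcs D \<Longrightarrow> other_side x \<in> W \<longleftrightarrow> x \<notin> W"
  using checkerboard by (cases x; cases "snd x") (auto simp: checkerboard_def)

lemma W_step:
  assumes "r < n" "j < 4"
  shows "end_at r ((j + 1) mod 4) \<in> W \<longleftrightarrow> end_at r j \<notin> W"
proof -
  have "fst (end_at r ((j + 1) mod 4)) \<in> arcs D"
    using arc_at_in_arcs[OF assms(1), of "(j + 1) mod 4"] by (simp add: slot_def)
  thus ?thesis using corner_step[OF W_saturated assms] other_side_W by blast
qed

lemma W_even:
  assumes "r < n" "j < 4"
  shows "end_at r j \<in> W \<longleftrightarrow> (even j \<longleftrightarrow> end_at r 0 \<in> W)"
proof -
  have "end_at r 1 \<in> W \<longleftrightarrow> end_at r 0 \<notin> W" using W_step[of r 0] assms by simp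
  moreover have "end_at r 2 \<in> W \<longleftrightarrow> end_at r 1 \<notin> W"
    using W_step[of r 1] assms by (simp add: numeral_2_eq_2)
  moreover have "end_at r 3 \<in> W \<longleftrightarrow> end_at r 2 \<notin> W" using W_step[of r 2] assms by simp
  ultimately show ?thesis using assms(2) less_4_iff[of j] by fastforce
qed

lemma W_partner: "r < n \<Longrightarrow> j < 4 \<Longrightarrow> end_at r (partner b j) \<in> W \<longleftrightarrow> end_at r j \<notin> W"
  using W_even[of r j] W_even[of r "partner b j"] partner_less[of j b]
  unfolding less_4_iff by (auto simp: partner_def split: if_splits)

lemma end_unique:
  assumes "arc_at r j = arc_at s k" "end_at r j \<in> W \<longleftrightarrow> end_at s k \<in> W" "r < n" "j < 4" "s < n" "k < 4"
  shows "r = s \<and> j = k"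
proof -
  have "fst (end_at r j) \<in> arcs D" using arc_at_in_arcs[OF assms(3,4)] by (simp add: slot_def)
  moreover have "fst (end_at r j) = fst (end_at s k)" using assms(1) by (simp add: slot_def)
  moreover from this have "end_at s k = end_at r j \<or> end_at s k = other_side (end_at r j)"
    by (auto simp: prod_eq_iff)
  ultimately have "end_at r j = end_at s k"
    using assms(2) other_side_W[of "end_at r j"] by metis
  thus ?thesis using end_at_inj assms by blast
qed

definition is_head :: "arc \<Rightarrow> nat \<times> nat \<Rightarrow> bool" where
  "is_head a = (\<lambda>(r, j). r < n \<and> j < 4 \<and> arc_at r j = a \<and> end_at r j \<notin> W)"

definition head :: "arc \<Rightarrow> nat \<times> nat" where
  "head a = (SOME e. is_head a e)"

text \<open>
  The successor of an arc on its circle, in the orientation just described.  Loops, which are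
  circles of their own, and numbers that are not arcs are fixed.
\<close>

definition next_arc :: "bool list \<Rightarrow> arc \<Rightarrow> arc" where
  "next_arc \<alpha> a = (if a \<in> set (in_arcs D)
     then arc_at (fst (head a)) (partner (\<alpha> ! fst (head a)) (snd (head a))) else a)"

lemma head_eq: "r < n \<Longrightarrow> j < 4 \<Longrightarrow> end_at r j \<notin> W \<Longrightarrow> head (arc_at r j) = (r, j)"
  unfolding head_def
proof (rule some_equality)
  assume r: "r < n" "j < 4" "end_at r j \<notin> W"
  thus "is_head (arc_at r j) (r, j)" by (simp add: is_head_def)
  fix e assume "is_head (arc_at r j) e"
  then obtain s k where "e = (s, k)" "s < n" "k < 4" "arc_at r j = arc_at s k" "end_at s k \<notin> W"
    by (auto simp: is_head_def)
  thus "e = (r, j)" using end_unique[of r j s k] r by blast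
qed

lemma obtain_head:
  assumes "a \<in> set (in_arcs D)"
  obtains r j where "r < n" "j < 4" "a = arc_at r j" "end_at r j \<notin> W" "head a = (r, j)"
proof -
  have "a \<in> arcs D" using assms by (simp add: arcs_eq)
  then obtain b where b: "(a, b) \<notin> W" using other_side_W[of "(a, True)"] by auto
  obtain r j where "r < n" "j < 4" "end_at r j = (a, b)" using obtain_end[OF assms] .
  moreover from this have "a = arc_at r j" by (simp add: slot_def)
  ultimately show thesis using that[of r j] b head_eq[of r j] by simp
qed

lemma next_arc_at: "r < n \<Longrightarrow> j < 4 \<Longrightarrow> end_at r j \<notin> W \<Longrightarrow>
    next_arc \<alpha> (arc_at r j) = arc_at r (partner (\<alpha> ! r) j)"
  by (simp add: next_arc_def arc_at_in head_eq)

lemma next_arc_permutes: "next_arc \<alpha> permutes set (in_arcs D)"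
proof (rule bij_imp_permutes)
  have "inj_on (next_arc \<alpha>) (set (in_arcs D))"
  proof (rule inj_onI)
    fix a b assume a: "a \<in> set (in_arcs D)" and b: "b \<in> set (in_arcs D)" and eq: "next_arc \<alpha> a = next_arc \<alpha> b"
    obtain r j where r: "r < n" "j < 4" "a = arc_at r j" "end_at r j \<notin> W" "head a = (r, j)"
      using obtain_head[OF a] .
    obtain s k where s: "s < n" "k < 4" "b = arc_at s k" "end_at s k \<notin> W" "head b = (s, k)"
      using obtain_head[OF b] .
    have "arc_at r (partner (\<alpha> ! r) j) = arc_at s (partner (\<alpha> ! s) k)"
      using eq r s by (simp add: next_arc_at)
    hence "r = s \<and> partner (\<alpha> ! r) j = partner (\<alpha> ! s) k"
      using end_unique r s W_partner partner_less by (metis (no_types, lifting))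
    thus "a = b" using r s partner_partner by metis
  qed
  moreover have "next_arc \<alpha> ` set (in_arcs D) \<subseteq> set (in_arcs D)"
  proof safe
    fix a assume a: "a \<in> set (in_arcs D)"
    obtain r j where r: "r < n" "j < 4" "a = arc_at r j" "end_at r j \<notin> W" "head a = (r, j)"
      using obtain_head[OF a] .
    thus "next_arc \<alpha> a \<in> set (in_arcs D)" by (simp add: next_arc_at arc_at_in partner_less)
  qed
  ultimately show "bij_betw (next_arc \<alpha>) (set (in_arcs D)) (set (in_arcs D))"
    by (simp add: bij_betw_def endo_inj_surj)
qed (simp add: next_arc_def)

lemma equivclp_smoothing: "equivclp (smoothing D \<alpha>) = equivclp (\<lambda>a b. b = next_arc \<alpha> a)"
proof (intro ext iffI)
  fix a b assume "equivclp (smoothing D \<alpha>) a b"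
  thus "equivclp (\<lambda>a b. b = next_arc \<alpha> a) a b"
  proof (induction rule: equivclp_induct)
    case base
    show ?case by (rule equivclp_refl)
  next
    case (step y z)
    have conn: "equivclp (\<lambda>a b. b = next_arc \<alpha> a) y z" if sm: "smoothing D \<alpha> y z" for y z
    proof -
      obtain r j where r: "r < n" "j < 4" "y = arc_at r j" "z = arc_at r (partner (\<alpha> ! r) j)"
        using smoothing_obtain_partner[OF sm] .
      show ?thesis
      proof (cases "end_at r j \<in> W")
        case True
        hence "y = next_arc \<alpha> z" using r by (simp add: next_arc_at W_partner partner_less partner_partner)
        thus ?thesis by (intro equivclp_sym[OF r_into_equivclp])
      next
        case False
        thus ?thesis using r by (intro r_into_equivclp) (simp add: next_arc_at)
      qed
    qed
    show ?case using step conn equivclp_trans equivclp_sym by metis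
  qed
next
  fix a b assume "equivclp (\<lambda>a b. b = next_arc \<alpha> a) a b"
  thus "equivclp (smoothing D \<alpha>) a b"
  proof (induction rule: equivclp_induct)
    case base
    show ?case by (rule equivclp_refl)
  next
    case (step y z)
    have conn: "equivclp (smoothing D \<alpha>) y (next_arc \<alpha> y)" for y
    proof (cases "y \<in> set (in_arcs D)")
      case True
      obtain r j where r: "r < n" "j < 4" "y = arc_at r j" "end_at r j \<notin> W" "head y = (r, j)"
        using obtain_head[OF True] .
      thus ?thesis using smoothing_partner[OF r(1,2), of \<alpha>] r_into_equivclp equivclp_sym
        by (metis next_arc_at)
    qed (simp add: next_arc_def equivclp_refl)
    show ?case using step conn equivclp_trans equivclp_sym by metis
  qed
qed

lemma next_arc_change:
  assumes r: "r < n" and \<alpha>: "length \<alpha> = n" "\<not> \<alpha> ! r" and i: "i < 2" "end_at r i \<in> W"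
  shows "next_arc (\<alpha>[r := True]) a = transpose (arc_at r i) (arc_at r (i + 2)) (next_arc \<alpha> a)"
proof (cases "a \<in> set (in_arcs D)")
  case False
  moreover have "arc_at r i \<in> set (in_arcs D)" "arc_at r (i + 2) \<in> set (in_arcs D)"
    using arc_at_in r i by auto
  ultimately show ?thesis by (auto simp: next_arc_def transpose_def)
next
  case True
  obtain s j where s: "s < n" "j < 4" "a = arc_at s j" "end_at s j \<notin> W" "head a = (s, j)"
    using obtain_head[OF True] .
  have W2: "end_at r (i + 2) \<in> W" using W_even[OF r, of i] W_even[OF r, of "i + 2"] i by simp
  show ?thesis
  proof (cases "s = r")
    case False
    have p: "end_at s (partner (\<alpha> ! s) j) \<in> W" "partner (\<alpha> ! s) j < 4"
      using s by (simp_all add: W_partner partner_less)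
    have "next_arc \<alpha> a \<noteq> arc_at r i" "next_arc \<alpha> a \<noteq> arc_at r (i + 2)"
      using end_unique[of s "partner (\<alpha> ! s) j" r i] end_unique[of s "partner (\<alpha> ! s) j" r "i + 2"]
        False p s r i W2 by (auto simp: next_arc_at)
    thus ?thesis using s False by (simp add: next_arc_at transpose_eq_iff)
  next
    case True
    have j: "even j \<longleftrightarrow> odd i" using W_even[OF r, of i] W_even[OF r, of j] i s True by auto
    have "next_arc (\<alpha>[r := True]) a = arc_at r (3 - j)" "next_arc \<alpha> a = arc_at r (partner False j)"
      using s True \<alpha> r by (simp_all add: next_arc_at partner_def)
    thus ?thesis using j i(1) s(2) unfolding less_4_iff less_2_cases_iff
      by (auto simp: partner_def numeral_3_eq_3)
  qed
qed

text \<open>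
  Changing a smoothing exchanges the two outgoing arcs of a crossing as successors, which composes
  the permutation with a transposition.  In particular a single circle never turns into a single
  circle, as it could on surfaces where no checkerboard colouring exists.
\<close>

lemma circles_merge_or_split:
  assumes r: "r < n" and \<alpha>: "length \<alpha> = n" "\<not> \<alpha> ! r"
  shows "circle_of D \<alpha> (arc_at r 0) = circle_of D \<alpha> (arc_at r 2) \<longleftrightarrow>
         circle_of D (\<alpha>[r := True]) (arc_at r 0) \<noteq> circle_of D (\<alpha>[r := True]) (arc_at r 2)"
proof -
  let ?\<alpha>' = "\<alpha>[r := True]"
  \<comment> \<open>The outgoing ends are at the positions 0 and 2 or at the positions 1 and 3.\<close>
  obtain i where i: "i < 2" "end_at r i \<in> W"
    using W_step[OF r, of 0] by (metis add_0 less_2_cases_iff mod_less one_less_numeral_iff semiring_norm(76) zero_less_numeral)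
  have W2: "end_at r (i + 2) \<in> W" using W_even[OF r, of i] W_even[OF r, of "i + 2"] i by simp
  have "arc_at r i \<noteq> arc_at r (i + 2)" using end_unique[of r i r "i + 2"] i W2 r by auto
  from transpose_toggles_connection[OF next_arc_permutes[of \<alpha>] _ this]
  have *: "circle_of D \<alpha> (arc_at r i) = circle_of D \<alpha> (arc_at r (i + 2)) \<longleftrightarrow>
      circle_of D ?\<alpha>' (arc_at r i) \<noteq> circle_of D ?\<alpha>' (arc_at r (i + 2))"
    by (simp add: circle_of_eq_iff equivclp_smoothing next_arc_change[OF r \<alpha> i])
  have "circle_of D \<alpha> (arc_at r 1) = circle_of D \<alpha> (arc_at r 0)"
    "circle_of D \<alpha> (arc_at r 3) = circle_of D \<alpha> (arc_at r 2)"
    "circle_of D ?\<alpha>' (arc_at r 3) = circle_of D ?\<alpha>' (arc_at r 0)"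
    "circle_of D ?\<alpha>' (arc_at r 2) = circle_of D ?\<alpha>' (arc_at r 1)"
    using circle_of_partner[OF r, of 0 \<alpha>] circle_of_partner[OF r, of 2 \<alpha>]
      circle_of_partner[OF r, of 0 ?\<alpha>'] circle_of_partner[OF r, of 1 ?\<alpha>'] r \<alpha>
    by (simp_all add: partner_def)
  moreover have "i = 0 \<or> i = 1" using i by auto
  moreover have "1 + 2 = (3::nat)" by simp
  ultimately show ?thesis using * by (metis add_0)
qed

text \<open>The two smoothings only relate the four ends at the crossing in a different way.\<close>

lemma circles_change:
  fixes r :: nat and \<alpha> :: "bool list"
  defines "\<alpha>' \<equiv> \<alpha>[r := True]"
  assumes r: "r < n" and \<alpha>: "length \<alpha> = n" "\<not> \<alpha> ! r"
  shows "circles D \<alpha>' - {circle_of D \<alpha>' (arc_at r 0), circle_of D \<alpha>' (arc_at r 2)} =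
         circles D \<alpha> - {circle_of D \<alpha> (arc_at r 0), circle_of D \<alpha> (arc_at r 2)}"
proof -
  define H where "H = arc_at r ` {..<4}"
  have sm: "smoothing D \<gamma> a b \<or> a \<in> H \<and> b \<in> H"
    if eq: "\<And>s. s \<noteq> r \<Longrightarrow> \<beta> ! s = \<gamma> ! s" and sb: "smoothing D \<beta> a b" for \<beta> \<gamma> a b
  proof -
    obtain s where s: "s < n"
      "if \<beta> ! s then (a, b) = (arc_at s 0, arc_at s 3) \<or> (a, b) = (arc_at s 1, arc_at s 2)
       else (a, b) = (arc_at s 0, arc_at s 1) \<or> (a, b) = (arc_at s 2, arc_at s 3)"
      using sb by (auto simp: smoothing_def Let_def)
    show ?thesis
    proof (cases "s = r")
      case True
      thus ?thesis using s(2) by (auto simp: H_def split: if_splits)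
    next
      case False
      thus ?thesis using s eq[OF False] unfolding smoothing_def Let_def by metis
    qed
  qed
  have same: "\<alpha> ! s = \<alpha>' ! s" if "s \<noteq> r" for s using that by (simp add: \<alpha>'_def)
  have H: "circle_of D \<beta> a \<in> {circle_of D \<beta> (arc_at r 0), circle_of D \<beta> (arc_at r 2)}"
    if "a \<in> H" for \<beta> a
  proof -
    have "circle_of D \<beta> (arc_at r (partner (\<beta> ! r) 0)) = circle_of D \<beta> (arc_at r 0)"
      "circle_of D \<beta> (arc_at r (partner (\<beta> ! r) 2)) = circle_of D \<beta> (arc_at r 2)"
      using circle_of_partner[OF r] by simp_all
    thus ?thesis using that unfolding H_def by (cases "\<beta> ! r") (auto simp: less_4_iff partner_def)
  qed
  have sub: "circles D \<beta> - {circle_of D \<beta> (arc_at r 0), circle_of D \<beta> (arc_at r 2)} \<subseteq>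
      circles D \<gamma> - {circle_of D \<gamma> (arc_at r 0), circle_of D \<gamma> (arc_at r 2)}"
    if eq: "\<And>s. s \<noteq> r \<Longrightarrow> \<beta> ! s = \<gamma> ! s" for \<beta> \<gamma>
  proof
    fix C assume C: "C \<in> circles D \<beta> - {circle_of D \<beta> (arc_at r 0), circle_of D \<beta> (arc_at r 2)}"
    then obtain a where a: "a \<in> arcs D" "C = circle_of D \<beta> a" by (auto simp: circles_eq)
    have dis: "C \<inter> H = {}"
    proof (rule ccontr)
      assume "C \<inter> H \<noteq> {}"
      then obtain b where "b \<in> H" "circle_of D \<beta> b = C" using a in_circle_of by blast
      thus False using H[of b \<beta>] C by auto
    qed
    have eq: "circle_of D \<beta> a = circle_of D \<gamma> a"
      unfolding circle_of_def
    proof (rule equivclp_class_unaffected)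
      show "{b. equivclp (smoothing D \<beta>) a b} \<inter> H = {}" using dis a by (simp add: circle_of_def)
    qed (use sm eq in auto)
    have "arc_at r 0 \<in> H" "arc_at r 2 \<in> H" by (auto simp: H_def)
    hence "C \<noteq> circle_of D \<gamma> (arc_at r 0)" "C \<noteq> circle_of D \<gamma> (arc_at r 2)"
      using dis in_circle_of by blast+
    thus "C \<in> circles D \<gamma> - {circle_of D \<gamma> (arc_at r 0), circle_of D \<gamma> (arc_at r 2)}"
      using a eq by (auto simp: circles_eq)
  qed
  show ?thesis using sub[of \<alpha> \<alpha>'] sub[of \<alpha>' \<alpha>] same by auto
qed

end

section \<open>Diagonalizing the edge maps\<close>

text \<open>
  Exchanging the sums, \<open>g R\<close> is counted once for every element of the interval from \<open>T\<close> to \<open>R\<close>.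
\<close>

lemma sum_supersets_involution:
  fixes g :: "'a set \<Rightarrow> bit"
  assumes fin: "finite A" and r: "\<And>a b. r a b \<Longrightarrow> a \<in> A \<and> b \<in> A" and T: "T \<in> saturated A r"
  shows "(\<Sum>U | U \<in> saturated A r \<and> T \<subseteq> U. \<Sum>R | R \<in> saturated A r \<and> U \<subseteq> R. g R) = g T"
proof -
  let ?S = "saturated A r"
  have finS: "finite ?S" by (rule finite_saturated[OF fin])
  have "(\<Sum>U | U \<in> ?S \<and> T \<subseteq> U. \<Sum>R | R \<in> ?S \<and> U \<subseteq> R. g R)
      = (\<Sum>R\<in>?S. \<Sum>U | U \<in> {U \<in> ?S. T \<subseteq> U} \<and> U \<subseteq> R. g R)"
    using sum.swap_restrict[of "{U \<in> ?S. T \<subseteq> U}" ?S "\<lambda>U R. g R" "\<lambda>U R. U \<subseteq> R"] finS by simp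
  also have "\<dots> = (\<Sum>R\<in>?S. if R = T then g R else 0)"
  proof (rule sum.cong[OF refl])
    fix R assume R: "R \<in> ?S"
    have "(\<Sum>U | U \<in> {U \<in> ?S. T \<subseteq> U} \<and> U \<subseteq> R. g R)
        = (\<Sum>U | U \<in> ?S \<and> T \<subseteq> U \<and> U \<subseteq> R. (1::bit)) * g R"
      by (simp add: sum_distrib_right conj_assoc)
    also have "\<dots> = (if R = T then g R else 0)"
    proof (cases "T \<subseteq> R")
      case True
      thus ?thesis using sum_saturated_interval[OF fin r T R] by simp
    next
      case False
      hence none: "{U. U \<in> ?S \<and> T \<subseteq> U \<and> U \<subseteq> R} = {}" and "R \<noteq> T" by auto
      thus ?thesis unfolding none by simp
    qed
    finally show "(\<Sum>U | U \<in> {U \<in> ?S. T \<subseteq> U} \<and> U \<subseteq> R. g R) = (if R = T then g R else 0)" .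
  qed
  also have "\<dots> = g T" using finS T by simp
  finally show ?thesis .
qed

text \<open>
  This is the statement that \<open>\<Delta>\<close> is diagonal in the basis \<open>x\<close>, \<open>y = 1 + x\<close>, read off in coordinates.
  The left hand side is the coordinate of \<open>\<Delta>(u)\<close> at the tensor whose two factors are \<open>y\<close> or \<open>x\<close>
  according to \<open>p\<close> and \<open>q\<close>, since \<open>1 = x + y\<close> has coordinate 1 at both \<open>x\<close> and \<open>y\<close>, and \<open>x\<close> only at \<open>x\<close>.
\<close>

lemma sum_gen_pairs:
  "(\<Sum>(g, h) | (g, h) \<in> comult_A u \<and> (p \<longrightarrow> g = One) \<and> (q \<longrightarrow> h = One). (1::bit))
     = of_bool (p = q \<and> (p \<longrightarrow> u = One))"
proof (cases u)
  case One
  have eq: "{(g, h). (g, h) \<in> comult_A u \<and> (p \<longrightarrow> g = One) \<and> (q \<longrightarrow> h = One)} =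
     (if p then {} else {(X, One)}) \<union> (if q then {} else {(One, X)}) \<union> {(One, One)}"
    using One by auto
  show ?thesis unfolding eq using One by (cases p; cases q) simp_all
next
  case X
  have eq: "{(g, h). (g, h) \<in> comult_A u \<and> (p \<longrightarrow> g = One) \<and> (q \<longrightarrow> h = One)} =
     (if p \<or> q then {} else {(X, X)})"
    using X by auto
  show ?thesis unfolding eq using X by (cases p; cases q) simp_all
qed

lemma mult_A_eq_One: "mult_A u v = One \<longleftrightarrow> u = One \<and> v = One"
  by (cases u; cases v) auto

context planar_diagram
begin

text \<open>
  The elements \<open>x\<close> and \<open>y = 1 + x\<close> are orthogonal idempotents of \<open>A\<close> with \<open>\<Delta>(x) = x \<otimes> x\<close> and
  \<open>\<Delta>(y) = y \<otimes> y\<close>.  The corresponding basis of \<open>V\<^sub>\<alpha>\<close> is indexed by the two-colourings of the circles,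
  given here as the set of the arcs on the circles coloured with \<open>y\<close>.
\<close>

definition colorings :: "bool list \<Rightarrow> arc set set" where
  "colorings \<alpha> = saturated (arcs D) (smoothing D \<alpha>)"

definition ones :: "bool list \<Rightarrow> (arc set \<Rightarrow> gen) \<Rightarrow> arc set" where
  "ones \<alpha> s = {a \<in> arcs D. s (circle_of D \<alpha> a) = One}"

lemma finite_circles: "finite (circles D \<alpha>)"
  by (simp add: circles_eq finite_arcs)

lemma finite_gen: "finite (UNIV :: gen set)"
proof -
  have "UNIV = {One, X}" using gen.exhaust by auto
  thus ?thesis by (metis finite.emptyI finite.insertI)
qed

lemma finite_labelings: "finite (labelings D \<alpha>)"
  unfolding labelings_def by (rule finite_PiE) (simp_all add: finite_circles finite_gen)

lemma finite_states: "finite (states D)"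
proof -
  have "vertices D = {xs. set xs \<subseteq> UNIV \<and> length xs = n}" by (auto simp: vertices_def)
  hence "finite (vertices D)" using finite_lists_length_eq[of "UNIV :: bool set" n] by simp
  thus ?thesis unfolding states_def by (rule finite_SigmaI) (rule finite_labelings)
qed

lemma coloring_meets_circle:
  assumes "T \<in> colorings \<alpha>"
  shows "circle_of D \<alpha> a \<inter> T \<noteq> {} \<longleftrightarrow> a \<in> T"
proof -
  have "b \<in> circle_of D \<alpha> a \<Longrightarrow> b \<in> T \<longleftrightarrow> a \<in> T" for b
    using saturated_equivclp[OF assms[unfolded colorings_def]] by (auto simp: circle_of_def)
  moreover have "a \<in> circle_of D \<alpha> a" by (simp add: in_circle_of)
  ultimately show ?thesis by blast
qed

lemma coloring_partner:
  assumes T: "T \<in> colorings \<alpha>" and "r < n" "j < 4"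
  shows "arc_at r (partner (\<alpha> ! r) j) \<in> T \<longleftrightarrow> arc_at r j \<in> T"
  using coloring_meets_circle[OF T] circle_of_partner[OF assms(2,3)] by metis

lemma coloringI:
  assumes "T \<subseteq> arcs D"
    and "\<And>r j. r < n \<Longrightarrow> j < 4 \<Longrightarrow> arc_at r (partner (\<alpha> ! r) j) \<in> T \<longleftrightarrow> arc_at r j \<in> T"
  shows "T \<in> colorings \<alpha>"
proof -
  have "a \<in> T \<longleftrightarrow> b \<in> T" if ab: "smoothing D \<alpha> a b" for a b
    using smoothing_obtain_partner[OF ab] assms(2) by metis
  thus ?thesis using assms(1) by (simp add: colorings_def saturated_def)
qed

lemma coloring_subset_arcs: "T \<in> colorings \<alpha> \<Longrightarrow> T \<subseteq> arcs D"
  by (simp add: colorings_def saturated_def)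

lemma bij_betw_ones: "bij_betw (ones \<alpha>) (labelings D \<alpha>) (colorings \<alpha>)"
proof (rule bij_betwI')
  fix s s' assume s: "s \<in> labelings D \<alpha>" and s': "s' \<in> labelings D \<alpha>"
  have "s = s'" if eq: "ones \<alpha> s = ones \<alpha> s'"
  proof (rule PiE_ext)
    show "s \<in> circles D \<alpha> \<rightarrow>\<^sub>E UNIV" "s' \<in> circles D \<alpha> \<rightarrow>\<^sub>E UNIV"
      using s s' by (simp_all add: labelings_def)
    fix C assume "C \<in> circles D \<alpha>"
    then obtain a where a: "a \<in> arcs D" "C = circle_of D \<alpha> a" by (auto simp: circles_eq)
    have "a \<in> ones \<alpha> s \<longleftrightarrow> a \<in> ones \<alpha> s'" using eq by simp
    hence "s C = One \<longleftrightarrow> s' C = One" using a by (simp add: ones_def)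
    thus "s C = s' C" using gen.exhaust by metis
  qed
  thus "ones \<alpha> s = ones \<alpha> s' \<longleftrightarrow> s = s'" by auto
next
  fix s
  have "circle_of D \<alpha> a = circle_of D \<alpha> b" if "smoothing D \<alpha> a b" for a b
    using that by (simp add: circle_of_eq_iff r_into_equivclp)
  thus "ones \<alpha> s \<in> colorings \<alpha>"
    using smoothing_arcs by (auto simp: colorings_def saturated_def ones_def)
next
  fix T assume T: "T \<in> colorings \<alpha>"
  define s where "s = (\<lambda>C\<in>circles D \<alpha>. if C \<inter> T \<noteq> {} then One else X)"
  have "s (circle_of D \<alpha> a) = One \<longleftrightarrow> a \<in> T" if "a \<in> arcs D" for a
    using that coloring_meets_circle[OF T, of a] by (simp add: s_def circles_eq)
  moreover have "T \<subseteq> arcs D" using T by (simp add: colorings_def saturated_def)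
  ultimately have "T = ones \<alpha> s" by (auto simp: ones_def)
  moreover have "s \<in> labelings D \<alpha>" by (simp add: s_def labelings_def)
  ultimately show "\<exists>s\<in>labelings D \<alpha>. T = ones \<alpha> s" by blast
qed

lemma sum_labelings_ones:
  "(\<Sum>s | s \<in> labelings D \<alpha> \<and> P (ones \<alpha> s). h (ones \<alpha> s)) = (\<Sum>U | U \<in> colorings \<alpha> \<and> P U. h U)"
proof (rule sum.reindex_bij_betw)
  have "ones \<alpha> ` {s. s \<in> labelings D \<alpha> \<and> P (ones \<alpha> s)} = {U. U \<in> colorings \<alpha> \<and> P U}"
    unfolding bij_betw_imp_surj_on[OF bij_betw_ones, symmetric] by auto
  moreover have "inj_on (ones \<alpha>) {s. s \<in> labelings D \<alpha> \<and> P (ones \<alpha> s)}"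
    by (rule inj_on_subset[OF bij_betw_imp_inj_on[OF bij_betw_ones]]) simp
  ultimately show "bij_betw (ones \<alpha>) {s. s \<in> labelings D \<alpha> \<and> P (ones \<alpha> s)} {U. U \<in> colorings \<alpha> \<and> P U}"
    by (simp add: bij_betw_def)
qed

lemma subset_ones_iff:
  assumes "T \<in> colorings \<alpha>"
  shows "T \<subseteq> ones \<alpha> s \<longleftrightarrow> (\<forall>C\<in>circles D \<alpha>. C \<inter> T \<noteq> {} \<longrightarrow> s C = One)"
proof -
  have "T \<subseteq> arcs D" using assms by (simp add: colorings_def saturated_def)
  thus ?thesis unfolding circles_eq ball_simps(9) coloring_meets_circle[OF assms] ones_def by blast
qed

text \<open>
  The coordinates of a chain with respect to the new basis.  Since \<open>1 = x + y\<close>, the coordinate at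
  the colouring \<open>T\<close> collects the labelings with label 1 on all circles coloured with \<open>y\<close>.
\<close>

definition color_sum :: "chain \<Rightarrow> bool list \<Rightarrow> arc set \<Rightarrow> bit" where
  "color_sum f \<alpha> T = (\<Sum>s | s \<in> labelings D \<alpha> \<and> T \<subseteq> ones \<alpha> s. f (\<alpha>, s))"

text \<open>
  The inverse change of basis has the same form, as \<open>y = 1 + x\<close> just like \<open>1 = y + x\<close>.
\<close>

definition from_colors :: "(bool list \<Rightarrow> arc set \<Rightarrow> bit) \<Rightarrow> chain" where
  "from_colors g = (\<lambda>(\<alpha>, s). if (\<alpha>, s) \<in> states D
     then \<Sum>T | T \<in> colorings \<alpha> \<and> ones \<alpha> s \<subseteq> T. g \<alpha> T else 0)"

lemma color_sum_add: "color_sum (\<lambda>x. f x + g x) \<alpha> T = color_sum f \<alpha> T + color_sum g \<alpha> T"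
  unfolding color_sum_def by (rule sum.distrib)

lemma color_sum_from_colors:
  assumes "length \<alpha> = n" "T \<in> colorings \<alpha>"
  shows "color_sum (from_colors g) \<alpha> T = g \<alpha> T"
proof -
  have "color_sum (from_colors g) \<alpha> T =
      (\<Sum>s | s \<in> labelings D \<alpha> \<and> T \<subseteq> ones \<alpha> s. \<Sum>R | R \<in> colorings \<alpha> \<and> ones \<alpha> s \<subseteq> R. g \<alpha> R)"
    unfolding color_sum_def from_colors_def
    using assms by (intro sum.cong) (auto simp: states_def vertices_def)
  also have "\<dots> = (\<Sum>U | U \<in> colorings \<alpha> \<and> T \<subseteq> U. \<Sum>R | R \<in> colorings \<alpha> \<and> U \<subseteq> R. g \<alpha> R)"
    by (rule sum_labelings_ones)
  also have "\<dots> = g \<alpha> T"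
    unfolding colorings_def
    by (rule sum_supersets_involution[OF finite_arcs smoothing_arcs assms(2)[unfolded colorings_def]])
  finally show ?thesis .
qed

lemma from_colors_color_sum:
  assumes "(\<alpha>, s) \<in> states D"
  shows "from_colors (color_sum f) (\<alpha>, s) = f (\<alpha>, s)"
proof -
  define h where "h U = f (\<alpha>, inv_into (labelings D \<alpha>) (ones \<alpha>) U)" for U
  have inj: "inj_on (ones \<alpha>) (labelings D \<alpha>)" using bij_betw_ones by (rule bij_betw_imp_inj_on)
  have h: "h (ones \<alpha> s) = f (\<alpha>, s)" if "s \<in> labelings D \<alpha>" for s
    using that inj by (simp add: h_def)
  have s: "s \<in> labelings D \<alpha>" using assms by (simp add: states_def)
  hence "ones \<alpha> s \<in> colorings \<alpha>" using bij_betw_ones bij_betwE by blast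
  hence *: "ones \<alpha> s \<in> saturated (arcs D) (smoothing D \<alpha>)" by (simp add: colorings_def)
  have "color_sum f \<alpha> T = (\<Sum>U | U \<in> colorings \<alpha> \<and> T \<subseteq> U. h U)" for T
    unfolding color_sum_def sum_labelings_ones[symmetric, where P = "\<lambda>U. T \<subseteq> U" and h = h] using h
    by (intro sum.cong) auto
  hence "from_colors (color_sum f) (\<alpha>, s) =
      (\<Sum>T | T \<in> colorings \<alpha> \<and> ones \<alpha> s \<subseteq> T. \<Sum>U | U \<in> colorings \<alpha> \<and> T \<subseteq> U. h U)"
    using assms by (simp add: from_colors_def)
  also have "\<dots> = h (ones \<alpha> s)"
    unfolding colorings_def by (rule sum_supersets_involution[OF finite_arcs smoothing_arcs *])
  finally show ?thesis using h s by simp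
qed

lemma chain_eqI:
  assumes "\<And>\<alpha> T. length \<alpha> = n \<Longrightarrow> T \<in> colorings \<alpha> \<Longrightarrow> color_sum f \<alpha> T = color_sum g \<alpha> T"
    and "\<And>x. x \<notin> states D \<Longrightarrow> f x = g x"
  shows "f = g"
proof (rule ext)
  fix x :: state
  obtain \<alpha> s where x: "x = (\<alpha>, s)" by (cases x)
  show "f x = g x"
  proof (cases "x \<in> states D")
    case True
    hence "length \<alpha> = n" by (simp add: x states_def vertices_def)
    hence "from_colors (color_sum f) x = from_colors (color_sum g) x"
      unfolding from_colors_def x using assms(1) by (auto intro: sum.cong)
    thus ?thesis using from_colors_color_sum True x by metis
  qed (rule assms(2))
qed

definition monochromatic :: "arc set \<Rightarrow> nat \<Rightarrow> bool" where
  "monochromatic T r \<longleftrightarrow> (\<forall>j<4. arc_at r j \<in> T \<longleftrightarrow> arc_at r 0 \<in> T)"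

text \<open>
  Either smoothing joins the four ends of the crossing in pairs, and both together connect all four.
\<close>

lemma coloring_update_iff:
  assumes T: "T \<in> colorings \<alpha>" and r: "r < n" and \<alpha>: "length \<alpha> = n" "\<alpha> ! r \<noteq> b"
  shows "T \<in> colorings (\<alpha>[r := b]) \<longleftrightarrow> monochromatic T r"
proof
  assume T': "T \<in> colorings (\<alpha>[r := b])"
  have "arc_at r (partner c j) \<in> T \<longleftrightarrow> arc_at r j \<in> T" if "j < 4" for c j
  proof (cases "c = b")
    case True
    thus ?thesis using coloring_partner[OF T' r that] r \<alpha>(1) by simp
  next
    case False
    hence "c = (\<alpha> ! r)" using \<alpha>(2) by auto
    thus ?thesis using coloring_partner[OF T r that] by simp
  qed
  from this[of 0 True] this[of 0 False] this[of 2 False]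
  have "arc_at r 3 \<in> T \<longleftrightarrow> arc_at r 0 \<in> T" "arc_at r 1 \<in> T \<longleftrightarrow> arc_at r 0 \<in> T"
    "arc_at r 3 \<in> T \<longleftrightarrow> arc_at r 2 \<in> T"
    by (simp_all add: partner_def)
  thus "monochromatic T r" unfolding monochromatic_def all_less_4 by blast
next
  assume m: "monochromatic T r"
  show "T \<in> colorings (\<alpha>[r := b])"
  proof (rule coloringI[OF coloring_subset_arcs[OF T]])
    fix s j assume sj: "s < n" "j < (4 :: nat)"
    show "arc_at s (partner (\<alpha>[r := b] ! s) j) \<in> T \<longleftrightarrow> arc_at s j \<in> T"
    proof (cases "s = r")
      case True
      show ?thesis
        using m sj(2) partner_less[OF sj(2)] unfolding monochromatic_def True by blast
    next
      case False
      thus ?thesis using coloring_partner[OF T sj] by simp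
    qed
  qed
qed

end

context checkerboard_diagram
begin

text \<open>
  In the new basis an edge map sends a colouring to itself if it is a colouring of the circles on
  both ends of the edge, and to 0 otherwise: this says that \<open>m\<close> and \<open>\<Delta>\<close> are diagonal.  The
  left hand side below is the coordinate at \<open>T\<close> of the image of the element \<open>s\<close> of the standard basis.
\<close>

lemma sum_edge_coeff:
  fixes r :: nat and \<alpha> :: "bool list"
  defines "\<alpha>' \<equiv> \<alpha>[r := True]"
  assumes r: "r < n" and \<alpha>: "length \<alpha> = n" "\<not> \<alpha> ! r" and T: "T \<in> colorings \<alpha>'"
    and s: "s \<in> labelings D \<alpha>"
  shows "(\<Sum>s' | s' \<in> labelings D \<alpha>' \<and> T \<subseteq> ones \<alpha>' s'. edge_coeff D r \<alpha> s s')
       = of_bool (T \<in> colorings \<alpha> \<and> T \<subseteq> ones \<alpha> s)"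
proof -
  define P Q P' Q' where "P = circle_of D \<alpha> (arc_at r 0)" and "Q = circle_of D \<alpha> (arc_at r 2)"
    and "P' = circle_of D \<alpha>' (arc_at r 0)" and "Q' = circle_of D \<alpha>' (arc_at r 2)"
  note defs = P_def Q_def P'_def Q'_def
  define N where "N = circles D \<alpha> - {P, Q}"
  define p q where "p \<longleftrightarrow> arc_at r 0 \<in> T" and "q \<longleftrightarrow> arc_at r 2 \<in> T"
  define okN where "okN \<longleftrightarrow> (\<forall>C\<in>N. C \<inter> T \<noteq> {} \<longrightarrow> s C = One)"
  have in_circles: "P \<in> circles D \<alpha>" "Q \<in> circles D \<alpha>" "P' \<in> circles D \<alpha>'" "Q' \<in> circles D \<alpha>'"
    using arc_at_in_arcs[OF r] by (simp_all add: defs circles_eq)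
  have N': "N = circles D \<alpha>' - {P', Q'}"
    using circles_change[OF r \<alpha>] by (simp add: N_def defs \<alpha>'_def)
  have c: "circles D \<alpha> = insert P (insert Q N)" and c': "circles D \<alpha>' = insert P' (insert Q' N)"
    using in_circles N_def N' by auto
  have notin: "P' \<notin> N" "Q' \<notin> N" by (simp_all add: N')
  have PQ: "P = Q \<longleftrightarrow> P' \<noteq> Q'"
    using circles_merge_or_split[OF r \<alpha>] by (simp add: defs \<alpha>'_def)
  have T_step: "T \<in> colorings \<alpha> \<longleftrightarrow> p = q"
  proof -
    have undo: "\<alpha> = \<alpha>'[r := False]" using \<alpha> by (metis \<alpha>'_def list_update_id list_update_overwrite)
    have \<alpha>': "length \<alpha>' = n" "\<alpha>' ! r \<noteq> False" using r \<alpha> by (simp_all add: \<alpha>'_def)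
    have "arc_at r (partner True j) \<in> T \<longleftrightarrow> arc_at r j \<in> T" if "j < 4" for j
      using coloring_partner[OF T r that] \<alpha>' by simp
    from this[of 0] this[of 2] have "arc_at r 3 \<in> T \<longleftrightarrow> p" "arc_at r 1 \<in> T \<longleftrightarrow> q"
      by (simp_all add: partner_def p_def q_def)
    moreover have "T \<in> colorings \<alpha> \<longleftrightarrow> monochromatic T r"
      using coloring_update_iff[OF T r \<alpha>'] undo by simp
    ultimately show ?thesis unfolding monochromatic_def all_less_4 p_def q_def by blast
  qed
  have meet': "P' \<inter> T \<noteq> {} \<longleftrightarrow> p" "Q' \<inter> T \<noteq> {} \<longleftrightarrow> q"
    using coloring_meets_circle[OF T] by (simp_all add: defs p_def q_def)
  have ones': "T \<subseteq> ones \<alpha>' s' \<longleftrightarrow> okN \<and> (p \<longrightarrow> s' P' = One) \<and> (q \<longrightarrow> s' Q' = One)"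
    if "\<forall>C\<in>N. s' C = s C" for s'
    unfolding subset_ones_iff[OF T] c' okN_def using that meet' by auto
  have ones: "T \<subseteq> ones \<alpha> s \<longleftrightarrow> okN \<and> (p \<longrightarrow> s P = One) \<and> (q \<longrightarrow> s Q = One)" if "p = q"
  proof -
    have T\<alpha>: "T \<in> colorings \<alpha>" using T_step that by simp
    have "P \<inter> T \<noteq> {} \<longleftrightarrow> p" "Q \<inter> T \<noteq> {} \<longleftrightarrow> q"
      using coloring_meets_circle[OF T\<alpha>] by (simp_all add: defs p_def q_def)
    thus ?thesis unfolding subset_ones_iff[OF T\<alpha>] c okN_def by auto
  qed
  let ?M = "{s'. s' \<in> labelings D \<alpha>' \<and> T \<subseteq> ones \<alpha>' s'}"
  have finM: "finite ?M" using finite_labelings by simp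
  have coeff: "edge_coeff D r \<alpha> s s' =
      (if \<exists>C\<in>N. s' C \<noteq> s C then 0
       else if P \<noteq> Q \<and> P' = Q' then of_bool (s' P' = mult_A (s P) (s Q))
       else if P = Q \<and> P' \<noteq> Q' then of_bool ((s' P', s' Q') \<in> comult_A (s P))
       else 0)" for s'
    by (simp add: edge_coeff_def Let_def defs N_def \<alpha>'_def)
  \<comment> \<open>The labelings that agree with \<open>s\<close> away from the crossing, where \<open>g\<close> counts if \<open>P' = Q'\<close>.\<close>
  define S where "S = (\<lambda>(g, h). \<lambda>C\<in>circles D \<alpha>'. if C = P' then g else if C = Q' then h else s C)"
  have S_lab: "S gh \<in> labelings D \<alpha>'" for gh by (cases gh) (simp add: S_def labelings_def)
  have S_vals: "\<forall>C\<in>N. S (g, h) C = s C" "S (g, h) P' = g" "P' \<noteq> Q' \<Longrightarrow> S (g, h) Q' = h" for g h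
    using notin c' by (auto simp: S_def)
  have S_eq: "s' = S (s' P', s' Q')" if "s' \<in> labelings D \<alpha>'" "\<forall>C\<in>N. s' C = s C" for s'
  proof (rule PiE_ext)
    show "s' \<in> circles D \<alpha>' \<rightarrow>\<^sub>E UNIV" "S (s' P', s' Q') \<in> circles D \<alpha>' \<rightarrow>\<^sub>E UNIV"
      using that(1) S_lab by (simp_all add: labelings_def)
    show "s' C = S (s' P', s' Q') C" if "C \<in> circles D \<alpha>'" for C
      using that \<open>\<forall>C\<in>N. s' C = s C\<close> by (auto simp: S_def c')
  qed
  have S_M: "S (g, h) \<in> ?M \<longleftrightarrow> okN \<and> (p \<longrightarrow> g = One) \<and> (q \<longrightarrow> (if P' = Q' then g else h) = One)" for g h
    using ones'[OF S_vals(1)] S_vals(2,3)[of g h] S_lab by auto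
  show ?thesis
  proof (cases "P = Q")
    case False
    hence P': "P' = Q'" using PQ by simp
    hence pq: "p = q" using meet' by simp
    define g where "g = mult_A (s P) (s Q)"
    have "edge_coeff D r \<alpha> s s' = of_bool (s' = S (g, g))" if "s' \<in> ?M" for s'
    proof (cases "\<forall>C\<in>N. s' C = s C")
      case True
      hence "s' = S (s' P', s' P')" using S_eq[of s'] that P' by simp
      moreover have "S (g, g) P' = g" by (rule S_vals)
      ultimately have "s' P' = g \<longleftrightarrow> s' = S (g, g)" by metis
      thus ?thesis using True False P' by (auto simp: coeff g_def)
    next
      case 2: False
      hence "s' \<noteq> S (g, g)" using S_vals(1) by auto
      thus ?thesis using 2 by (auto simp: coeff)
    qed
    hence "(\<Sum>s'\<in>?M. edge_coeff D r \<alpha> s s') = (\<Sum>s'\<in>?M. if s' = S (g, g) then 1 else 0)"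
      by (intro sum.cong) auto
    also have "\<dots> = of_bool (S (g, g) \<in> ?M)" using finM by simp
    also have "S (g, g) \<in> ?M \<longleftrightarrow> T \<in> colorings \<alpha> \<and> T \<subseteq> ones \<alpha> s"
      using S_M T_step ones[OF pq] pq P' by (auto simp: g_def mult_A_eq_One)
    finally show ?thesis .
  next
    case True
    hence P': "P' \<noteq> Q'" using PQ by simp
    have inj: "inj_on S K" for K
    proof (rule inj_onI)
      fix x y assume "S x = S y"
      thus "x = y" using S_vals(2) S_vals(3)[OF P'] by (metis prod.collapse)
    qed
    have "edge_coeff D r \<alpha> s s' = of_bool (s' \<in> S ` comult_A (s P))" if "s' \<in> ?M" for s'
    proof (cases "\<forall>C\<in>N. s' C = s C")
      case 2: True
      hence s': "s' = S (s' P', s' Q')" using S_eq[of s'] that by simp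
      have "(s' P', s' Q') \<in> comult_A (s P) \<longleftrightarrow> S (s' P', s' Q') \<in> S ` comult_A (s P)"
        using inj_on_image_mem_iff[OF inj[of UNIV]] by auto
      thus ?thesis using 2 True P' s' by (auto simp: coeff)
    next
      case 2: False
      hence "s' \<notin> S ` comult_A (s P)" using S_vals(1) by fastforce
      thus ?thesis using 2 by (auto simp: coeff)
    qed
    hence "(\<Sum>s'\<in>?M. edge_coeff D r \<alpha> s s') = (\<Sum>s'\<in>?M. if s' \<in> S ` comult_A (s P) then 1 else 0)"
      by (intro sum.cong) auto
    also have "\<dots> = (\<Sum>s'\<in>?M \<inter> S ` comult_A (s P). 1)"
      by (rule sum.inter_restrict[OF finM, symmetric])
    also have "?M \<inter> S ` comult_A (s P) = S ` {(g, h). (g, h) \<in> comult_A (s P) \<and> S (g, h) \<in> ?M}"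
      by auto
    also have "(\<Sum>s'\<in>\<dots>. 1) = (\<Sum>(g, h) | (g, h) \<in> comult_A (s P) \<and> S (g, h) \<in> ?M. (1::bit))"
      by (subst sum.reindex[OF inj]) (simp add: case_prod_unfold)
    also have "\<dots> = of_bool (T \<in> colorings \<alpha> \<and> T \<subseteq> ones \<alpha> s)"
    proof (cases okN)
      case True
      hence "S (g, h) \<in> ?M \<longleftrightarrow> (p \<longrightarrow> g = One) \<and> (q \<longrightarrow> h = One)" for g h
        unfolding S_M using P' by simp
      hence "(\<Sum>(g, h) | (g, h) \<in> comult_A (s P) \<and> S (g, h) \<in> ?M. (1::bit))
          = of_bool (p = q \<and> (p \<longrightarrow> s P = One))"
        by (simp only: sum_gen_pairs)
      also have "p = q \<and> (p \<longrightarrow> s P = One) \<longleftrightarrow> T \<in> colorings \<alpha> \<and> T \<subseteq> ones \<alpha> s"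
        using T_step ones True \<open>P = Q\<close> by metis
      finally show ?thesis .
    next
      case False
      thus ?thesis unfolding S_M using T_step ones by auto
    qed
    finally show ?thesis .
  qed
qed

text \<open>
  A colouring survives along the edges between smoothings that it is a colouring of, which are the
  edges in the directions of its monochromatic crossings.
\<close>

theorem color_sum_differential:
  assumes \<alpha>: "length \<alpha> = n" and T: "T \<in> colorings \<alpha>"
  shows "color_sum (differential D f) \<alpha> T =
    (\<Sum>r | r < n \<and> \<alpha> ! r \<and> monochromatic T r. color_sum f (\<alpha>[r := False]) T)"
proof -
  let ?L = "{s'. s' \<in> labelings D \<alpha> \<and> T \<subseteq> ones \<alpha> s'}"
  let ?R = "{r. r < n \<and> \<alpha> ! r}"
  let ?c = "\<lambda>r s s'. edge_coeff D r (\<alpha>[r := False]) s s' * f (\<alpha>[r := False], s)"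
  have undo: "\<alpha>[r := False, r := True] = \<alpha>" if "\<alpha> ! r" for r
    using that by (metis list_update_id list_update_overwrite)
  have d: "differential D f (\<alpha>, s') = (\<Sum>r\<in>?R. \<Sum>s\<in>labelings D (\<alpha>[r := False]). ?c r s s')"
    if s': "s' \<in> labelings D \<alpha>" for s'
  proof -
    have st: "(\<alpha>, s') \<in> states D" using \<alpha> s' by (simp add: states_def vertices_def)
    have "differential D f (\<alpha>, s') = (\<Sum>x\<in>states D. \<Sum>r | r < n \<and> \<not> fst x ! r \<and> \<alpha> = (fst x)[r := True].
        edge_coeff D r (fst x) (snd x) s' * f x)"
      using st by (simp add: differential_def case_prod_unfold)
    also have "\<dots> = (\<Sum>(x, r) \<in> (SIGMA x:states D. {r. r < n \<and> \<not> fst x ! r \<and> \<alpha> = (fst x)[r := True]}).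
        edge_coeff D r (fst x) (snd x) s' * f x)"
      by (rule sum.Sigma) (simp_all add: finite_states)
    also have "\<dots> = (\<Sum>(r, s) \<in> (SIGMA r:?R. labelings D (\<alpha>[r := False])). ?c r s s')"
    proof (rule sum.reindex_bij_witness[where
          i = "\<lambda>(r, s). ((\<alpha>[r := False], s), r)" and j = "\<lambda>(x, r). (r, snd x)"])
      fix a assume "a \<in> (SIGMA x:states D. {r. r < n \<and> \<not> fst x ! r \<and> \<alpha> = (fst x)[r := True]})"
      then obtain \<beta> s r where a: "a = ((\<beta>, s), r)" "length \<beta> = n" "s \<in> labelings D \<beta>"
          "r < n" "\<not> \<beta> ! r" "\<alpha> = \<beta>[r := True]"
        by (auto simp: states_def vertices_def)
      hence \<beta>: "\<beta>[r := False] = \<beta>" by (metis list_update_id)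
      show "(case case a of (x, r) \<Rightarrow> (r, snd x) of (r, s) \<Rightarrow> ((\<alpha>[r := False], s), r)) = a"
        "(case a of (x, r) \<Rightarrow> (r, snd x)) \<in> (SIGMA r:?R. labelings D (\<alpha>[r := False]))"
        "(case case a of (x, r) \<Rightarrow> (r, snd x) of (r, s) \<Rightarrow> ?c r s s') =
          (case a of (x, r) \<Rightarrow> edge_coeff D r (fst x) (snd x) s' * f x)"
        using a by (simp_all add: \<beta>)
    next
      fix b assume "b \<in> (SIGMA r:?R. labelings D (\<alpha>[r := False]))"
      then obtain r s where b: "b = (r, s)" "r < n" "\<alpha> ! r" "s \<in> labelings D (\<alpha>[r := False])" by auto
      thus "(case case b of (r, s) \<Rightarrow> ((\<alpha>[r := False], s), r) of (x, r) \<Rightarrow> (r, snd x)) = b"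
        "(case b of (r, s) \<Rightarrow> ((\<alpha>[r := False], s), r)) \<in>
          (SIGMA x:states D. {r. r < n \<and> \<not> fst x ! r \<and> \<alpha> = (fst x)[r := True]})"
        using \<alpha> undo by (auto simp: states_def vertices_def)
    qed
    also have "\<dots> = (\<Sum>r\<in>?R. \<Sum>s\<in>labelings D (\<alpha>[r := False]). ?c r s s')"
      by (rule sum.Sigma[symmetric]) (simp_all add: finite_labelings)
    finally show ?thesis .
  qed
  have "color_sum (differential D f) \<alpha> T =
      (\<Sum>s'\<in>?L. \<Sum>r\<in>?R. \<Sum>s\<in>labelings D (\<alpha>[r := False]). ?c r s s')"
    unfolding color_sum_def using d by (intro sum.cong) auto
  also have "\<dots> = (\<Sum>r\<in>?R. \<Sum>s\<in>labelings D (\<alpha>[r := False]). \<Sum>s'\<in>?L. ?c r s s')"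
    by (subst sum.swap) (intro sum.cong refl sum.swap)
  also have "\<dots> = (\<Sum>r\<in>?R. if T \<in> colorings (\<alpha>[r := False]) then color_sum f (\<alpha>[r := False]) T else 0)"
  proof (rule sum.cong[OF refl])
    fix r assume r: "r \<in> ?R"
    let ?\<beta> = "\<alpha>[r := False]"
    have "(\<Sum>s'\<in>?L. ?c r s s') = of_bool (T \<in> colorings ?\<beta> \<and> T \<subseteq> ones ?\<beta> s) * f (?\<beta>, s)"
      if s: "s \<in> labelings D ?\<beta>" for s
    proof -
      have "(\<Sum>s'\<in>?L. edge_coeff D r ?\<beta> s s') = of_bool (T \<in> colorings ?\<beta> \<and> T \<subseteq> ones ?\<beta> s)"
        using sum_edge_coeff[of r ?\<beta> T s] r \<alpha> T s undo[of r] by simp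
      thus ?thesis by (simp only: sum_distrib_right[symmetric])
    qed
    hence "(\<Sum>s\<in>labelings D ?\<beta>. \<Sum>s'\<in>?L. ?c r s s')
        = (\<Sum>s\<in>labelings D ?\<beta>. of_bool (T \<in> colorings ?\<beta> \<and> T \<subseteq> ones ?\<beta> s) * f (?\<beta>, s))"
      by simp
    also have "\<dots> = (if T \<in> colorings ?\<beta> then color_sum f ?\<beta> T else 0)"
    proof (cases "T \<in> colorings ?\<beta>")
      case True
      have "(\<Sum>s\<in>labelings D ?\<beta>. of_bool (T \<subseteq> ones ?\<beta> s) * f (?\<beta>, s))
          = (\<Sum>s\<in>labelings D ?\<beta>. if T \<subseteq> ones ?\<beta> s then f (?\<beta>, s) else 0)"
        by (intro sum.cong) auto
      also have "\<dots> = color_sum f ?\<beta> T"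
        unfolding color_sum_def by (rule sum.inter_filter[symmetric, OF finite_labelings])
      finally show ?thesis using True by simp
    qed simp
    finally show "(\<Sum>s\<in>labelings D ?\<beta>. \<Sum>s'\<in>?L. ?c r s s')
        = (if T \<in> colorings ?\<beta> then color_sum f ?\<beta> T else 0)" .
  qed
  also have "\<dots> = (\<Sum>r | r \<in> ?R \<and> T \<in> colorings (\<alpha>[r := False]). color_sum f (\<alpha>[r := False]) T)"
    by (rule sum.inter_filter[symmetric]) simp
  also have "{r. r \<in> ?R \<and> T \<in> colorings (\<alpha>[r := False])} = {r. r < n \<and> \<alpha> ! r \<and> monochromatic T r}"
    using coloring_update_iff[OF T _ \<alpha>] by auto
  finally show ?thesis .
qed

end

section \<open>Dimensions over the field with two elements\<close>

(* Chains are added and scaled as vectors here, not as bit strings. *)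
declare add_bit_eq_xor [simp del] mult_bit_eq_and [simp del]

lemma bit_add_self [simp]: "x + x = (0 :: bit)"
  by (cases x) simp_all

lemma bit_add_eq_0_iff: "x + y = 0 \<longleftrightarrow> x = (y :: bit)"
  by (cases x; cases y) simp_all

text \<open>
  A basis identifies the space with the functions from the basis to the field.  This allows one to
  determine dimensions by counting.
\<close>

lemma card_bit_vectorspace:
  fixes V :: "(bit, 'v) module"
  assumes V: "vectorspace class_ring V" and finite_V: "finite (carrier V)"
  shows "card (carrier V) = 2 ^ vectorspace.dim class_ring V"
proof -
  interpret vectorspace "class_ring :: bit ring" V by (rule V)
  have "span (carrier V) = carrier V"
    using in_own_span[of "carrier V"] span_is_subset2[of "carrier V"] by auto
  hence "fin_dim" unfolding fin_dim_def using finite_V by blast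
  then obtain \<beta> where \<beta>: "finite \<beta>" "basis \<beta>" using finite_basis_exists by auto
  have dim: "dim = card \<beta>" using dim_basis[OF \<beta>] .
  have li: "lin_indpt \<beta>" and gen: "gen_set \<beta>" and sub: "\<beta> \<subseteq> carrier V"
    using \<beta>(2) by (auto simp: basis_def)
  have all: "a \<in> \<beta> \<rightarrow> carrier (class_ring :: bit ring)" for a :: "'v \<Rightarrow> bit" by simp
  have double: "v \<oplus>\<^bsub>V\<^esub> v = \<zero>\<^bsub>V\<^esub>" if v: "v \<in> carrier V" for v
  proof -
    have "v \<oplus>\<^bsub>V\<^esub> v = (1 + 1 :: bit) \<odot>\<^bsub>V\<^esub> v"
      using smult_l_distr[of 1 1 v] smult_one[OF v] v by simp
    thus ?thesis using smult_l_null[OF v] by simp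
  qed
  have "bij_betw (\<lambda>a. lincomb a \<beta>) (\<beta> \<rightarrow>\<^sub>E UNIV) (carrier V)"
    unfolding bij_betw_def
  proof
    show "inj_on (\<lambda>a. lincomb a \<beta>) (\<beta> \<rightarrow>\<^sub>E (UNIV :: bit set))"
    proof (rule inj_onI)
      fix a b :: "'v \<Rightarrow> bit"
      assume a: "a \<in> \<beta> \<rightarrow>\<^sub>E UNIV" and b: "b \<in> \<beta> \<rightarrow>\<^sub>E UNIV" and eq: "lincomb a \<beta> = lincomb b \<beta>"
      have "lincomb (\<lambda>v. a v + b v) \<beta> = lincomb a \<beta> \<oplus>\<^bsub>V\<^esub> lincomb b \<beta>"
        using lincomb_sum[OF \<beta>(1) sub all all, of a b] by simp
      also have "\<dots> = \<zero>\<^bsub>V\<^esub>"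
        using eq double lincomb_closed[OF sub all, of b] by simp
      finally have "a v + b v = 0" if "v \<in> \<beta>" for v
        using not_lindepD[OF li \<beta>(1) subset_refl all, of "\<lambda>v. a v + b v"] that by auto
      hence "a v = b v" if "v \<in> \<beta>" for v using that by (simp add: bit_add_eq_0_iff)
      with a b show "a = b" by (rule PiE_ext)
    qed
    have "carrier V = {lincomb a \<beta> |a. a \<in> \<beta> \<rightarrow> carrier (class_ring :: bit ring)}"
      using finite_span[OF \<beta>(1) sub] gen by simp
    also have "\<dots> = (\<lambda>a. lincomb a \<beta>) ` (\<beta> \<rightarrow>\<^sub>E UNIV)"
    proof -
      have "lincomb a \<beta> = lincomb (restrict a \<beta>) \<beta>" for a
        by (rule lincomb_cong[OF refl sub]) (simp_all add: sub)
      thus ?thesis by (force simp: image_iff)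
    qed
    finally show "(\<lambda>a. lincomb a \<beta>) ` (\<beta> \<rightarrow>\<^sub>E (UNIV :: bit set)) = carrier V" ..
  qed
  hence "card (carrier V) = card (\<beta> \<rightarrow>\<^sub>E (UNIV :: bit set))" by (rule bij_betw_same_card[symmetric])
  also have "\<dots> = 2 ^ card \<beta>"
  proof -
    have bits: "UNIV = {0, 1 :: bit}" using bit_not_one_iff by auto
    have "card (UNIV :: bit set) = 2" unfolding bits by simp
    thus ?thesis using \<beta>(1) by (simp add: card_PiE)
  qed
  finally show ?thesis using dim by simp
qed

text \<open>
  The cosets of \<open>B\<close> in \<open>Z\<close> correspond to the values of \<open>\<Phi>\<close> on \<open>Z\<close>, of which there are \<open>2\<^bsup>|G|\<^esup>\<close>.
\<close>

lemma dim_quotient_space: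
  fixes V :: "(bit, 's \<Rightarrow> bit) module" and Z B :: "('s \<Rightarrow> bit) set" and G :: "'g set"
    and \<Phi> :: "('s \<Rightarrow> bit) \<Rightarrow> 'g \<Rightarrow> bit"
  assumes V: "carrier V = Z" "zero V = (\<lambda>_. 0)" "add V = (\<lambda>f g x. f x + g x)"
      "smult V = (\<lambda>k f x. k * f x)"
    and Z0: "(\<lambda>_. 0) \<in> Z" and Zadd: "\<And>f g. f \<in> Z \<Longrightarrow> g \<in> Z \<Longrightarrow> (\<lambda>x. f x + g x) \<in> Z"
    and B0: "(\<lambda>_. 0) \<in> B" and Badd: "\<And>f g. f \<in> B \<Longrightarrow> g \<in> B \<Longrightarrow> (\<lambda>x. f x + g x) \<in> B"
    and \<Phi>_add: "\<And>f g. \<Phi> (\<lambda>x. f x + g x) = (\<lambda>y. \<Phi> f y + \<Phi> g y)"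
    and \<Phi>_B: "\<And>f. f \<in> B \<Longrightarrow> \<Phi> f = (\<lambda>_. 0)"
    and \<Phi>_ker: "\<And>f. f \<in> Z \<Longrightarrow> \<Phi> f = (\<lambda>_. 0) \<Longrightarrow> f \<in> B"
    and \<Phi>_image: "\<Phi> ` Z = {g. \<forall>y. y \<notin> G \<longrightarrow> g y = 0}" and G: "finite G"
  shows "vectorspace.dim class_ring (quotient_space V B) = card G"
proof -
  define coset where "coset f = (\<lambda>b x. b x + f x) ` B" for f
  have coset: "B +>\<^bsub>V\<^esub> f = coset f" for f
    by (auto simp: a_r_coset_def r_coset_def V coset_def)
  have coset_subset: "coset f \<subseteq> coset g" if "(\<lambda>x. f x + g x) \<in> B" for f g
  proof
    fix h assume "h \<in> coset f"
    then obtain b where b: "b \<in> B" "h = (\<lambda>x. b x + f x)" by (auto simp: coset_def)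
    have "h = (\<lambda>x. (b x + (f x + g x)) + g x)" unfolding b(2) by (simp add: add.assoc)
    thus "h \<in> coset g" unfolding coset_def by (rule image_eqI[OF _ Badd[OF b(1) that]])
  qed
  have coset_eq: "coset f = coset g \<longleftrightarrow> \<Phi> f = \<Phi> g" if fg: "f \<in> Z" "g \<in> Z" for f g
  proof
    assume "coset f = coset g"
    moreover have "f \<in> coset f" unfolding coset_def using B0 by force
    ultimately obtain b where b: "b \<in> B" "f = (\<lambda>x. b x + g x)" by (auto simp: coset_def)
    thus "\<Phi> f = \<Phi> g" using \<Phi>_add[of b g] \<Phi>_B by simp
  next
    assume "\<Phi> f = \<Phi> g"
    hence "\<Phi> (\<lambda>x. f x + g x) = (\<lambda>_. 0)" by (simp add: \<Phi>_add)
    hence "(\<lambda>x. f x + g x) \<in> B" using \<Phi>_ker Zadd fg by blast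
    moreover from this have "(\<lambda>x. g x + f x) \<in> B" by (simp add: add.commute)
    ultimately show "coset f = coset g" using coset_subset by blast
  qed
  let ?W = "quotient_space V B"
  have carrier: "carrier ?W = coset ` Z"
    by (auto simp: quotient_space_def A_RCOSETS_def RCOSETS_def r_coset_def V coset_def)
  have zero: "\<zero>\<^bsub>?W\<^esub> = coset (\<lambda>_. 0)" by (simp add: quotient_space_def coset_def)
  have add: "coset f \<oplus>\<^bsub>?W\<^esub> coset g = coset (\<lambda>x. f x + g x)" for f g
  proof (rule Set.set_eqI, rule iffI)
    fix h assume "h \<in> coset f \<oplus>\<^bsub>?W\<^esub> coset g"
    then obtain b c where b: "b \<in> B" "c \<in> B" "h = (\<lambda>x. (b x + f x) + (c x + g x))"
      by (auto simp: quotient_space_def set_add_def set_mult_def V coset_def)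
    have "h = (\<lambda>x. (b x + c x) + (f x + g x))" unfolding b(3) by (simp add: ac_simps)
    thus "h \<in> coset (\<lambda>x. f x + g x)" using Badd[OF b(1,2)] by (auto simp: coset_def)
  next
    fix h assume "h \<in> coset (\<lambda>x. f x + g x)"
    then obtain b where b: "b \<in> B" "h = (\<lambda>x. b x + (f x + g x))" by (auto simp: coset_def)
    have "h = (\<lambda>x. (b x + f x) + (0 + g x))" unfolding b(2) by (simp add: ac_simps)
    moreover have "(\<lambda>x. b x + f x) \<in> coset f" unfolding coset_def using b(1) by blast
    moreover have "(\<lambda>x. 0 + g x) \<in> coset g" unfolding coset_def by (rule image_eqI[OF refl B0])
    ultimately show "h \<in> coset f \<oplus>\<^bsub>?W\<^esub> coset g"
      by (force simp: quotient_space_def set_add_def set_mult_def V)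
  qed
  have smult: "k \<odot>\<^bsub>?W\<^esub> coset f = coset (\<lambda>x. k * f x)" for k f
  proof (cases "k = 0")
    case True
    have "k \<odot>\<^bsub>?W\<^esub> coset f = (\<Union>v\<in>coset f. coset (\<lambda>_. 0))"
      by (simp add: quotient_space_def coset V True)
    also have "\<dots> = coset (\<lambda>x. k * f x)" using B0 True by (auto simp: coset_def)
    finally show ?thesis .
  next
    case False
    hence k: "k = 1" by (metis bit_not_zero_iff)
    have "coset v = coset f" if v: "v \<in> coset f" for v
    proof -
      obtain b where b: "b \<in> B" "v = (\<lambda>x. b x + f x)" using v by (auto simp: coset_def)
      have "(\<lambda>x. v x + f x) \<in> B" "(\<lambda>x. f x + v x) \<in> B"
        using b(1) by (simp_all add: b(2) add.assoc add.left_commute)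
      thus ?thesis using coset_subset by blast
    qed
    hence "(\<Union>v\<in>coset f. coset v) = coset f" using B0 by (auto simp: coset_def)
    thus ?thesis by (simp add: quotient_space_def coset V k)
  qed
  have Zsmult: "(\<lambda>x. k * f x) \<in> Z" if "f \<in> Z" for k f
    using that Z0 by (cases k) simp_all
  have neg: "\<exists>h\<in>Z. coset (\<lambda>x. f x + h x) = coset (\<lambda>_. 0)" if "f \<in> Z" for f
    using that by (intro bexI[of _ f]) simp_all
  have vs: "vectorspace class_ring ?W"
    by (rule vs_criteria[OF class_field], unfold carrier zero)
      (auto simp: add smult Z0 Zadd Zsmult neg algebra_simps)
  have "finite {g :: 'g \<Rightarrow> bit. \<forall>y. y \<notin> G \<longrightarrow> g y = 0} \<and>
      card {g :: 'g \<Rightarrow> bit. \<forall>y. y \<notin> G \<longrightarrow> g y = 0} = 2 ^ card G"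
  proof -
    have "bij_betw (\<lambda>U y. of_bool (y \<in> U)) (Pow G) {g :: 'g \<Rightarrow> bit. \<forall>y. y \<notin> G \<longrightarrow> g y = 0}"
      by (rule bij_betw_byWitness[where f' = "\<lambda>g. {y. g y = 1}"]) (auto simp: fun_eq_iff)
    from bij_betw_finite[OF this] bij_betw_same_card[OF this] show ?thesis
      using G by (simp add: card_Pow)
  qed
  moreover have "bij_betw (\<lambda>C. \<Phi> (inv_into Z coset C)) (coset ` Z) (\<Phi> ` Z)"
  proof -
    have "\<Phi> (inv_into Z coset (coset f)) = \<Phi> f" if "f \<in> Z" for f
      using coset_eq[of "inv_into Z coset (coset f)" f] that
      by (simp add: f_inv_into_f inv_into_into)
    thus ?thesis using coset_eq by (auto simp: bij_betw_def inj_on_def image_image)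
  qed
  ultimately have "finite (carrier ?W)" "card (carrier ?W) = 2 ^ card G"
    unfolding carrier \<Phi>_image by (auto simp: bij_betw_finite bij_betw_same_card)
  thus ?thesis using card_bit_vectorspace[OF vs] by simp
qed

section \<open>Homology\<close>

lemma count_list_True: "count_list xs True = card {r. r < length xs \<and> xs ! r}"
  by (simp add: count_list_eq_length_filter length_filter_conv_card)

lemma count_list_update_True:
  assumes "r < length xs" "\<not> xs ! r"
  shows "count_list (xs[r := True]) True = count_list xs True + 1"
proof -
  have "{i. i < length xs \<and> xs[r := True] ! i} = insert r {i. i < length xs \<and> xs ! i}"
    using assms by (auto simp: nth_list_update)
  thus ?thesis using assms by (simp add: count_list_True)
qed

context checkerboard_diagram
begin

definition degree :: "bool list \<Rightarrow> int" where
  "degree \<alpha> = int (count_list \<alpha> True) - int (n_minus D)"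

lemma degree_update: "length \<alpha> = n \<Longrightarrow> r < n \<Longrightarrow> \<not> \<alpha> ! r \<Longrightarrow> degree (\<alpha>[r := True]) = degree \<alpha> + 1"
  by (simp add: degree_def count_list_update_True)

lemma chain_space_iff: "f \<in> carrier (chain_space D i) \<longleftrightarrow>
    (\<forall>x. x \<notin> states D \<longrightarrow> f x = 0) \<and> (\<forall>\<alpha> s. degree \<alpha> \<noteq> i \<longrightarrow> f (\<alpha>, s) = 0)"
  by (auto simp: chain_space_def degree_states_def degree_def)

lemma from_colors_in_chain_space:
  assumes "\<And>\<alpha> T. length \<alpha> = n \<Longrightarrow> T \<in> colorings \<alpha> \<Longrightarrow> degree \<alpha> \<noteq> i \<Longrightarrow> g \<alpha> T = 0"
  shows "from_colors g \<in> carrier (chain_space D i)"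
  unfolding chain_space_iff using assms
  by (auto simp: from_colors_def states_def vertices_def intro!: sum.neutral)

lemma color_sum_degree: "f \<in> carrier (chain_space D i) \<Longrightarrow> degree \<alpha> \<noteq> i \<Longrightarrow> color_sum f \<alpha> T = 0"
  by (simp add: chain_space_iff color_sum_def)

lemma color_sum_zero: "color_sum (\<lambda>_. 0) \<alpha> T = 0"
  by (simp add: color_sum_def)

lemma differential_outside: "x \<notin> states D \<Longrightarrow> differential D f x = 0"
  by (cases x) (simp add: differential_def)

lemma differential_add:
  "differential D (\<lambda>x. f x + g x) = (\<lambda>x. differential D f x + differential D g x)"
proof (rule chain_eqI)
  fix \<alpha> T assume \<alpha>: "length \<alpha> = n" "T \<in> colorings \<alpha>"
  show "color_sum (differential D (\<lambda>x. f x + g x)) \<alpha> T =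
      color_sum (\<lambda>x. differential D f x + differential D g x) \<alpha> T"
    unfolding color_sum_add color_sum_differential[OF \<alpha>] by (rule sum.distrib)
next
  fix x assume "x \<notin> states D"
  thus "differential D (\<lambda>x. f x + g x) x = differential D f x + differential D g x"
    by (simp add: differential_outside)
qed

lemma differential_zero: "differential D (\<lambda>_. 0) = (\<lambda>_. 0)"
proof (rule chain_eqI)
  fix \<alpha> T assume \<alpha>: "length \<alpha> = n" "T \<in> colorings \<alpha>"
  show "color_sum (differential D (\<lambda>_. 0)) \<alpha> T = color_sum (\<lambda>_. 0) \<alpha> T"
    unfolding color_sum_differential[OF \<alpha>] color_sum_zero by simp
qed (rule differential_outside)

text \<open>
  In the basis of colourings the complex is a direct sum over the colourings \<open>T\<close> of the arcs, and
  the summand of \<open>T\<close>, unless it is zero, is a cube whose dimension is the number of monochromatic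
  crossings of \<open>T\<close>.  A cube of positive dimension is acyclic, and a cube of dimension 0 is a single generator.
\<close>

definition generators :: "int \<Rightarrow> (bool list \<times> arc set) set" where
  "generators i = {(\<alpha>, T). length \<alpha> = n \<and> T \<in> colorings \<alpha> \<and> (\<forall>r<n. \<not> monochromatic T r) \<and> degree \<alpha> = i}"

definition generator_part :: "int \<Rightarrow> chain \<Rightarrow> bool list \<times> arc set \<Rightarrow> bit" where
  "generator_part i f = (\<lambda>(\<alpha>, T). if (\<alpha>, T) \<in> generators i then color_sum f \<alpha> T else 0)"

lemma finite_generators: "finite (generators i)"
proof (rule finite_subset)
  show "generators i \<subseteq> {xs. set xs \<subseteq> UNIV \<and> length xs = n} \<times> Pow (arcs D)"
    using coloring_subset_arcs by (auto simp: generators_def)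
  show "finite ({xs. set xs \<subseteq> (UNIV :: bool set) \<and> length xs = n} \<times> Pow (arcs D))"
    using finite_lists_length_eq[OF finite_UNIV] finite_arcs by (intro finite_cartesian_product) auto
qed

text \<open>The differential only reaches the colourings with a monochromatic crossing.\<close>

lemma generator_part_boundary: "generator_part i (differential D f) = (\<lambda>_. 0)"
proof
  fix x :: "bool list \<times> arc set"
  obtain \<alpha> T where x: "x = (\<alpha>, T)" by (cases x)
  have "color_sum (differential D f) \<alpha> T = 0" if "(\<alpha>, T) \<in> generators i"
  proof -
    have "length \<alpha> = n" "T \<in> colorings \<alpha>" using that by (auto simp: generators_def)
    moreover have none: "{r. r < n \<and> \<alpha> ! r \<and> monochromatic T r} = {}"
      using that by (auto simp: generators_def)
    ultimately show ?thesis by (simp only: color_sum_differential none sum.empty)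
  qed
  thus "generator_part i (differential D f) x = 0" by (simp add: generator_part_def x)
qed

text \<open>
  The cube of a colouring \<open>T\<close> is contracted in the direction of the first monochromatic crossing of
  \<open>T\<close>: a coordinate of \<open>f\<close> with entry 1 in this direction is moved to the vertex with entry 0.  If the
  entry is 0, the cycle condition one step further recovers the coordinate.
\<close>

lemma cycle_without_generators:
  assumes f: "f \<in> cycles D i" and gen: "generator_part i f = (\<lambda>_. 0)"
  shows "f \<in> boundaries D i"
proof -
  have fc: "f \<in> carrier (chain_space D i)" and df: "differential D f = (\<lambda>_. 0)"
    using f by (auto simp: cycles_def)
  define mono where "mono T \<longleftrightarrow> (\<exists>r<n. monochromatic T r)" for T
  define first where "first T = (LEAST r. r < n \<and> monochromatic T r)" for T
  have first: "first T < n" "monochromatic T (first T)" if "mono T" for T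
    using LeastI_ex[of "\<lambda>r. r < n \<and> monochromatic T r"] that by (auto simp: mono_def first_def)
  define e where "e \<alpha> T = (if mono T \<and> \<not> \<alpha> ! first T then color_sum f (\<alpha>[first T := True]) T else 0)"
    for \<alpha> T
  have e_deg: "e \<alpha> T = 0" if "length \<alpha> = n" "degree \<alpha> \<noteq> i - 1" for \<alpha> T
    using that first[of T] color_sum_degree[OF fc] degree_update[of \<alpha> "first T"] by (auto simp: e_def)
  have "from_colors e \<in> carrier (chain_space D (i - 1))"
    using e_deg by (intro from_colors_in_chain_space)
  moreover have "differential D (from_colors e) = f"
  proof (rule chain_eqI)
    fix \<alpha> T assume \<alpha>: "length \<alpha> = n" and T: "T \<in> colorings \<alpha>"
    define M where "M = {r. r < n \<and> \<alpha> ! r \<and> monochromatic T r}"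
    have finM: "finite M" by (simp add: M_def)
    have "color_sum (differential D (from_colors e)) \<alpha> T
        = (\<Sum>r\<in>M. color_sum (from_colors e) (\<alpha>[r := False]) T)"
      unfolding M_def by (rule color_sum_differential[OF \<alpha> T])
    also have "\<dots> = (\<Sum>r\<in>M. e (\<alpha>[r := False]) T)"
    proof (rule sum.cong[OF refl])
      fix r assume "r \<in> M"
      hence "T \<in> colorings (\<alpha>[r := False])"
        using coloring_update_iff[OF T _ \<alpha>] by (auto simp: M_def)
      thus "color_sum (from_colors e) (\<alpha>[r := False]) T = e (\<alpha>[r := False]) T"
        using \<alpha> by (intro color_sum_from_colors) auto
    qed
    also have "\<dots> = color_sum f \<alpha> T"
    proof (cases "mono T")
      case False
      hence "M = {}" by (auto simp: M_def mono_def)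
      moreover have "color_sum f \<alpha> T = 0"
      proof (cases "degree \<alpha> = i")
        case True
        hence "(\<alpha>, T) \<in> generators i" using False \<alpha> T by (auto simp: generators_def mono_def)
        thus ?thesis using fun_cong[OF gen, of "(\<alpha>, T)"] by (simp add: generator_part_def)
      next
        case False
        thus ?thesis by (rule color_sum_degree[OF fc])
      qed
      ultimately show ?thesis by simp
    next
      case True
      define q where "q = first T"
      have q: "q < n" "monochromatic T q" using first[OF True] by (simp_all add: q_def)
      have e: "e \<beta> T = (if \<beta> ! q then 0 else color_sum f (\<beta>[q := True]) T)" for \<beta>
        using True by (simp add: e_def q_def)
      show ?thesis
      proof (cases "\<alpha> ! q")
        case True
        have "(\<Sum>r\<in>M. e (\<alpha>[r := False]) T) = (\<Sum>r\<in>M. if r = q then color_sum f \<alpha> T else 0)"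
        proof (rule sum.cong[OF refl])
          fix r assume "r \<in> M"
          have undo: "\<alpha>[q := False, q := True] = \<alpha>"
            using True by (metis list_update_id list_update_overwrite)
          show "e (\<alpha>[r := False]) T = (if r = q then color_sum f \<alpha> T else 0)"
            using True q(1) \<alpha> undo by (simp add: e)
        qed
        also have "\<dots> = color_sum f \<alpha> T" using finM q True by (simp add: M_def)
        finally show ?thesis .
      next
        case False
        let ?\<gamma> = "\<alpha>[q := True]"
        have \<gamma>: "length ?\<gamma> = n" "T \<in> colorings ?\<gamma>"
          using \<alpha> q False coloring_update_iff[OF T q(1) \<alpha>, of True] by simp_all
        have M\<gamma>: "{r. r < n \<and> ?\<gamma> ! r \<and> monochromatic T r} = insert q M"
          using q \<alpha> by (auto simp: M_def nth_list_update)
        have qM: "q \<notin> M" using False by (simp add: M_def)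
        have undo: "?\<gamma>[q := False] = \<alpha>" using False by (metis list_update_id list_update_overwrite)
        have "0 = color_sum (differential D f) ?\<gamma> T" by (simp only: df color_sum_zero)
        also have "\<dots> = (\<Sum>r\<in>insert q M. color_sum f (?\<gamma>[r := False]) T)"
          by (simp only: color_sum_differential[OF \<gamma>] M\<gamma>)
        also have "\<dots> = color_sum f \<alpha> T + (\<Sum>r\<in>M. color_sum f (?\<gamma>[r := False]) T)"
          using finM qM undo by simp
        also have "(\<Sum>r\<in>M. color_sum f (?\<gamma>[r := False]) T) = (\<Sum>r\<in>M. e (\<alpha>[r := False]) T)"
        proof (rule sum.cong[OF refl])
          fix r assume "r \<in> M"
          hence "r \<noteq> q" using qM by auto
          thus "color_sum f (?\<gamma>[r := False]) T = e (\<alpha>[r := False]) T"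
            using False by (simp add: e list_update_swap)
        qed
        finally show ?thesis using bit_add_eq_0_iff by metis
      qed
    qed
    finally show "color_sum (differential D (from_colors e)) \<alpha> T = color_sum f \<alpha> T" .
  next
    fix x assume "x \<notin> states D"
    thus "differential D (from_colors e) x = f x"
      using fc by (cases x) (simp add: differential_outside chain_space_iff)
  qed
  ultimately show ?thesis unfolding boundaries_def by (metis imageI)
qed

text \<open>
  A function on generators is a cycle, since no edge starts at a generator.
\<close>

lemma generator_part_onto:
  assumes g: "\<And>x. x \<notin> generators i \<Longrightarrow> g x = 0"
  shows "\<exists>f\<in>cycles D i. generator_part i f = g"
proof
  let ?f = "from_colors (curry g)"
  have cs: "color_sum ?f \<alpha> T = g (\<alpha>, T)" if "length \<alpha> = n" "T \<in> colorings \<alpha>" for \<alpha> T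
    using color_sum_from_colors[OF that, of "curry g"] by simp
  have "?f \<in> carrier (chain_space D i)"
    by (rule from_colors_in_chain_space) (simp add: g generators_def)
  moreover have "differential D ?f = (\<lambda>_. 0)"
  proof (rule chain_eqI)
    fix \<alpha> T assume \<alpha>: "length \<alpha> = n" and T: "T \<in> colorings \<alpha>"
    have "color_sum ?f (\<alpha>[r := False]) T = 0" if "r < n" "\<alpha> ! r" "monochromatic T r" for r
    proof -
      have "T \<in> colorings (\<alpha>[r := False])" using coloring_update_iff[OF T _ \<alpha>] that by simp
      moreover have "(\<alpha>[r := False], T) \<notin> generators i" using that by (auto simp: generators_def)
      ultimately show ?thesis using \<alpha> by (simp add: cs g)
    qed
    thus "color_sum (differential D ?f) \<alpha> T = color_sum (\<lambda>_. 0) \<alpha> T"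
      unfolding color_sum_differential[OF \<alpha> T] color_sum_zero by (intro sum.neutral) auto
  qed (rule differential_outside)
  ultimately show "?f \<in> cycles D i" by (simp add: cycles_def)
  have "generator_part i ?f x = g x" for x
    using g[of x] by (cases x) (auto simp: generator_part_def generators_def cs)
  thus "generator_part i ?f = g" ..
qed

theorem BN_dim_eq: "BN_dim D i = card (generators i)"
  unfolding BN_def
proof (rule dim_quotient_space[where Z = "cycles D i" and \<Phi> = "generator_part i"])
  show "carrier (chain_space D i\<lparr>carrier := cycles D i\<rparr>) = cycles D i"
    "\<zero>\<^bsub>chain_space D i\<lparr>carrier := cycles D i\<rparr>\<^esub> = (\<lambda>_. 0)"
    "add (chain_space D i\<lparr>carrier := cycles D i\<rparr>) = (\<lambda>f g x. f x + g x)"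
    "smult (chain_space D i\<lparr>carrier := cycles D i\<rparr>) = (\<lambda>k f x. k * f x)"
    by (simp_all add: chain_space_def)
next
  show "(\<lambda>_. 0) \<in> cycles D i" by (simp add: cycles_def chain_space_def differential_zero)
  have C0: "(\<lambda>_. 0) \<in> carrier (chain_space D j)" for j by (simp add: chain_space_def)
  have C_add: "(\<lambda>x. f x + g x) \<in> carrier (chain_space D j)"
    if "f \<in> carrier (chain_space D j)" "g \<in> carrier (chain_space D j)" for f g j
    using that by (simp add: chain_space_def)
  show "(\<lambda>x. f x + g x) \<in> cycles D i" if "f \<in> cycles D i" "g \<in> cycles D i" for f g
    using that C_add by (simp add: cycles_def differential_add)
  show "(\<lambda>_. 0) \<in> boundaries D i"
    unfolding boundaries_def using C0 differential_zero by (metis imageI)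
  show "(\<lambda>x. f x + g x) \<in> boundaries D i" if "f \<in> boundaries D i" "g \<in> boundaries D i" for f g
    using that C_add unfolding boundaries_def by (auto simp: differential_add[symmetric])
  show "generator_part i (\<lambda>x. f x + g x) = (\<lambda>y. generator_part i f y + generator_part i g y)" for f g
    by (auto simp: generator_part_def color_sum_add)
  show "generator_part i f = (\<lambda>_. 0)" if "f \<in> boundaries D i" for f
    using that generator_part_boundary by (auto simp: boundaries_def)
  show "generator_part i ` cycles D i = {g. \<forall>y. y \<notin> generators i \<longrightarrow> g y = 0}"
  proof
    show "generator_part i ` cycles D i \<subseteq> {g. \<forall>y. y \<notin> generators i \<longrightarrow> g y = 0}"
      by (auto simp: generator_part_def)
    show "{g. \<forall>y. y \<notin> generators i \<longrightarrow> g y = 0} \<subseteq> generator_part i ` cycles D i"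
      using generator_part_onto by blast
  qed
qed (use cycle_without_generators finite_generators in auto)

end

section \<open>Generators and linking numbers\<close>

context planar_diagram
begin

lemma strand_arcs: "strand D a b \<Longrightarrow> a \<in> arcs D \<and> b \<in> arcs D"
  by (auto simp: strand_def arcs_def in_arcs_def out_arcs_def)

lemma in_arcs_at:
  assumes "r < n"
  shows "under_in (crossings D ! r) \<in> arcs D" "over_in (crossings D ! r) \<in> arcs D"
  using nth_mem[OF assms] by (auto simp: arcs_def in_arcs_def)

lemma saturated_strand_iff:
  "E \<in> saturated (arcs D) (strand D) \<longleftrightarrow> E \<subseteq> arcs D \<and>
     (\<forall>r<n. (arc_at r 0 \<in> E \<longleftrightarrow> arc_at r 2 \<in> E) \<and> (arc_at r 1 \<in> E \<longleftrightarrow> arc_at r 3 \<in> E))"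
proof -
  have slots: "slot c 0 = under_in c" "slot c 2 = under_out c"
    "slot c 1 = (if positive c then over_out c else over_in c)"
    "slot c 3 = (if positive c then over_in c else over_out c)" for c
    by (simp_all add: slot_def ends_def)
  have "(\<forall>a b. strand D a b \<longrightarrow> (a \<in> E \<longleftrightarrow> b \<in> E)) \<longleftrightarrow>
      (\<forall>c\<in>set (crossings D). (under_in c \<in> E \<longleftrightarrow> under_out c \<in> E) \<and> (over_in c \<in> E \<longleftrightarrow> over_out c \<in> E))"
    by (auto simp: strand_def)
  also have "\<dots> \<longleftrightarrow> (\<forall>r<n. (arc_at r 0 \<in> E \<longleftrightarrow> arc_at r 2 \<in> E) \<and> (arc_at r 1 \<in> E \<longleftrightarrow> arc_at r 3 \<in> E))"
    unfolding all_set_conv_all_nth slots by auto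
  finally show ?thesis by (simp add: saturated_def)
qed

text \<open>
  The signed number of crossings between the components inside and outside of \<open>E\<close>, that is,
  twice the linking number of \<open>E\<close> with its complement.
\<close>

definition cut :: "arc set \<Rightarrow> int" where
  "cut E = (\<Sum>r<n. if (under_in (crossings D ! r) \<in> E) \<noteq> (over_in (crossings D ! r) \<in> E)
     then crossing_sign (crossings D ! r) else 0)"

end

context checkerboard_diagram
begin

definition left_black :: "arc set" where
  "left_black = {a \<in> arcs D. (a, True) \<in> W}"

lemma left_black_iff:
  assumes "r < n" "j < 4"
  shows "arc_at r j \<in> left_black \<longleftrightarrow> (end_at r j \<in> W \<longleftrightarrow> snd (end_at r j))"
proof -
  have a: "fst (end_at r j) \<in> arcs D" "arc_at r j = fst (end_at r j)"
    using arc_at_in_arcs[OF assms] by (simp_all add: slot_def)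
  show ?thesis
    using a other_side_W[OF a(1)] by (cases "end_at r j"; cases "snd (end_at r j)") (auto simp: left_black_def)
qed

text \<open>
  The faces around a crossing alternate in colour.  The ends 0 and 2 of the lower strand face
  opposite directions, and so do the ends 1 and 3 of the upper strand, but the sign of the crossing
  decides whether the ends 0 and 1 do.
\<close>

lemma left_black_opposite:
  assumes "r < n"
  shows "arc_at r 0 \<in> left_black \<longleftrightarrow> arc_at r 2 \<notin> left_black"
    "arc_at r 1 \<in> left_black \<longleftrightarrow> arc_at r 3 \<notin> left_black"
    "arc_at r 0 \<in> left_black \<longleftrightarrow> (arc_at r 1 \<in> left_black \<longleftrightarrow> positive (crossings D ! r))"
proof -
  have "end_at r 0 \<in> W \<longleftrightarrow> end_at r 2 \<in> W" "end_at r 1 \<in> W \<longleftrightarrow> end_at r 3 \<in> W"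
    "end_at r 0 \<in> W \<longleftrightarrow> end_at r 1 \<notin> W"
    using W_even[OF assms, of 1] W_even[OF assms, of 2] W_even[OF assms, of 3] by auto
  moreover have "\<not> snd (end_at r 0)" "snd (end_at r 2)" "snd (end_at r 1) \<longleftrightarrow> positive (crossings D ! r)"
    "snd (end_at r 3) \<longleftrightarrow> \<not> positive (crossings D ! r)"
    by (simp_all add: ends_def)
  moreover have "arc_at r j \<in> left_black \<longleftrightarrow> (end_at r j \<in> W \<longleftrightarrow> snd (end_at r j))" if "j \<in> {0,1,2,3}" for j
    using left_black_iff[OF assms, of j] that by auto
  ultimately show "arc_at r 0 \<in> left_black \<longleftrightarrow> arc_at r 2 \<notin> left_black"
    "arc_at r 1 \<in> left_black \<longleftrightarrow> arc_at r 3 \<notin> left_black"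
    "arc_at r 0 \<in> left_black \<longleftrightarrow> (arc_at r 1 \<in> left_black \<longleftrightarrow> positive (crossings D ! r))"
    by auto
qed

definition smoothing_of :: "arc set \<Rightarrow> bool list" where
  "smoothing_of T = map (\<lambda>r. (arc_at r 0 \<in> T) \<noteq> (arc_at r 1 \<in> T)) [0..<n]"

lemma smoothing_of_nth: "r < n \<Longrightarrow> smoothing_of T ! r \<longleftrightarrow> (arc_at r 0 \<in> T) \<noteq> (arc_at r 1 \<in> T)"
  and length_smoothing_of: "length (smoothing_of T) = n"
  by (simp_all add: smoothing_of_def)

lemma two_colored_crossing:
  assumes "r < n"
  shows "(\<forall>j<4. arc_at r (partner b j) \<in> T \<longleftrightarrow> arc_at r j \<in> T) \<and> \<not> monochromatic T r \<longleftrightarrow>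
    (arc_at r 0 \<in> T \<longleftrightarrow> arc_at r 2 \<notin> T) \<and> (arc_at r 1 \<in> T \<longleftrightarrow> arc_at r 3 \<notin> T) \<and>
    (b \<longleftrightarrow> (arc_at r 0 \<in> T) \<noteq> (arc_at r 1 \<in> T))"
  unfolding monochromatic_def all_less_4 by (cases b) (auto simp: partner_def)

text \<open>
  Describe an orientation of the link by the union \<open>E\<close> of the components that are reversed, and
  colour an arc according to the colour of the face on its left in this orientation.  Relative to
  the given orientation this exchanges the two colours on \<open>E\<close>.  At a crossing the left sides of a
  strand before and after the crossing have opposite colours, and conversely this property of a
  colouring says that the corresponding \<open>E\<close> does not change along strands.
\<close>

lemma generators_iff:
  "(\<alpha>, T) \<in> generators i \<longleftrightarrow>
     \<alpha> = smoothing_of T \<and> sym_diff T left_black \<in> saturated (arcs D) (strand D) \<and> degree \<alpha> = i"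
proof -
  have "(\<alpha>, T) \<in> generators i \<longleftrightarrow> length \<alpha> = n \<and> T \<subseteq> arcs D \<and> degree \<alpha> = i \<and>
      (\<forall>r<n. (\<forall>j<4. arc_at r (partner (\<alpha> ! r) j) \<in> T \<longleftrightarrow> arc_at r j \<in> T) \<and> \<not> monochromatic T r)"
  proof -
    have "T \<in> colorings \<alpha> \<longleftrightarrow>
        T \<subseteq> arcs D \<and> (\<forall>r<n. \<forall>j<4. arc_at r (partner (\<alpha> ! r) j) \<in> T \<longleftrightarrow> arc_at r j \<in> T)"
      using coloring_partner[of T \<alpha>] coloring_subset_arcs[of T \<alpha>] coloringI[of T \<alpha>] by blast
    thus ?thesis unfolding generators_def by blast
  qed
  also have "\<dots> \<longleftrightarrow> length \<alpha> = n \<and> T \<subseteq> arcs D \<and> degree \<alpha> = i \<and>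
      (\<forall>r<n. (arc_at r 0 \<in> T \<longleftrightarrow> arc_at r 2 \<notin> T) \<and> (arc_at r 1 \<in> T \<longleftrightarrow> arc_at r 3 \<notin> T) \<and>
        \<alpha> ! r = smoothing_of T ! r)"
    using two_colored_crossing smoothing_of_nth by auto
  also have "\<dots> \<longleftrightarrow> \<alpha> = smoothing_of T \<and> T \<subseteq> arcs D \<and> degree \<alpha> = i \<and>
      (\<forall>r<n. (arc_at r 0 \<in> T \<longleftrightarrow> arc_at r 2 \<notin> T) \<and> (arc_at r 1 \<in> T \<longleftrightarrow> arc_at r 3 \<notin> T))"
    using length_smoothing_of[of T] by (auto simp: list_eq_iff_nth_eq)
  also have "\<dots> \<longleftrightarrow> \<alpha> = smoothing_of T \<and> sym_diff T left_black \<in> saturated (arcs D) (strand D) \<and> degree \<alpha> = i"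
  proof -
    have "left_black \<subseteq> arcs D" by (auto simp: left_black_def)
    hence "T \<subseteq> arcs D \<longleftrightarrow> sym_diff T left_black \<subseteq> arcs D" by blast
    moreover have "(arc_at r 0 \<in> T \<longleftrightarrow> arc_at r 2 \<notin> T) \<and> (arc_at r 1 \<in> T \<longleftrightarrow> arc_at r 3 \<notin> T) \<longleftrightarrow>
        (arc_at r 0 \<in> sym_diff T left_black \<longleftrightarrow> arc_at r 2 \<in> sym_diff T left_black) \<and>
        (arc_at r 1 \<in> sym_diff T left_black \<longleftrightarrow> arc_at r 3 \<in> sym_diff T left_black)" if "r < n" for r
      using left_black_opposite[OF that] by blast
    ultimately show ?thesis unfolding saturated_strand_iff by blast
  qed
  finally show ?thesis .
qed

text \<open>
  A crossing contributes to the degree if its smoothing for \<open>E\<close> differs from the oriented one, which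
  happens if exactly one of its two strands is reversed.
\<close>

lemma degree_smoothing_of:
  assumes E: "E \<in> saturated (arcs D) (strand D)"
  shows "degree (smoothing_of (sym_diff E left_black)) = cut E"
proof -
  let ?T = "sym_diff E left_black"
  let ?c = "\<lambda>r. crossings D ! r"
  have at: "int (of_bool (smoothing_of ?T ! r)) - int (of_bool (\<not> positive (?c r))) =
      (if (under_in (?c r) \<in> E) \<noteq> (over_in (?c r) \<in> E) then crossing_sign (?c r) else 0)"
    if r: "r < n" for r
  proof -
    have "under_in (?c r) = arc_at r 0" "over_in (?c r) = (if positive (?c r) then arc_at r 3 else arc_at r 1)"
      by (simp_all add: slot_def ends_def)
    moreover have "arc_at r 1 \<in> E \<longleftrightarrow> arc_at r 3 \<in> E" using E r unfolding saturated_strand_iff by blast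
    ultimately have uo: "(under_in (?c r) \<in> E) \<noteq> (over_in (?c r) \<in> E) \<longleftrightarrow> (arc_at r 0 \<in> E) \<noteq> (arc_at r 1 \<in> E)"
      by auto
    have "smoothing_of ?T ! r \<longleftrightarrow> (((arc_at r 0 \<in> E) \<noteq> (arc_at r 1 \<in> E)) \<longleftrightarrow> positive (?c r))"
      using left_black_opposite(3)[OF r] unfolding smoothing_of_nth[OF r] by blast
    thus ?thesis unfolding uo by (auto simp: crossing_sign_def)
  qed
  have "degree (smoothing_of ?T) = int (card {r \<in> {..<n}. smoothing_of ?T ! r}) - int (card {r \<in> {..<n}. \<not> positive (?c r)})"
    by (simp add: degree_def count_list_True length_smoothing_of n_minus_def length_filter_conv_card)
  also have "\<dots> = (\<Sum>r<n. int (of_bool (smoothing_of ?T ! r)) - int (of_bool (\<not> positive (?c r))))"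
  proof -
    have "int (card {r \<in> {..<n}. P r}) = (\<Sum>r<n. int (of_bool (P r)))" for P
    proof -
      have "(\<Sum>r<n. int (of_bool (P r))) = (\<Sum>r<n. if P r then 1 else 0)" by (intro sum.cong) auto
      also have "\<dots> = (\<Sum>r\<in>{r \<in> {..<n}. P r}. 1)" by (rule sum.inter_filter[symmetric]) simp
      finally show ?thesis by simp
    qed
    thus ?thesis by (simp only: sum_subtractf)
  qed
  also have "\<dots> = cut E" unfolding cut_def using at by (intro sum.cong) auto
  finally show ?thesis .
qed

lemma card_generators: "card (generators i) = card {E \<in> saturated (arcs D) (strand D). cut E = i}"
proof -
  have invol: "sym_diff (sym_diff A left_black) left_black = A" for A by blast
  have "bij_betw (\<lambda>E. (smoothing_of (sym_diff E left_black), sym_diff E left_black))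
      {E \<in> saturated (arcs D) (strand D). cut E = i} (generators i)"
  proof (rule bij_betw_byWitness[where f' = "\<lambda>(\<alpha>, T). sym_diff T left_black"])
    show "\<forall>E\<in>{E \<in> saturated (arcs D) (strand D). cut E = i}.
        (case (smoothing_of (sym_diff E left_black), sym_diff E left_black) of (\<alpha>, T) \<Rightarrow> sym_diff T left_black) = E"
      using invol by simp
    show "\<forall>x\<in>generators i. (smoothing_of (sym_diff (case x of (\<alpha>, T) \<Rightarrow> sym_diff T left_black) left_black),
        sym_diff (case x of (\<alpha>, T) \<Rightarrow> sym_diff T left_black) left_black) = x"
      using invol by (auto simp: generators_iff)
    show "(\<lambda>E. (smoothing_of (sym_diff E left_black), sym_diff E left_black)) `
        {E \<in> saturated (arcs D) (strand D). cut E = i} \<subseteq> generators i"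
      using invol degree_smoothing_of by (auto simp: generators_iff)
    show "(\<lambda>(\<alpha>, T). sym_diff T left_black) ` generators i \<subseteq> {E \<in> saturated (arcs D) (strand D). cut E = i}"
      using invol degree_smoothing_of by (auto simp: generators_iff) metis
  qed
  thus ?thesis by (rule bij_betw_same_card[symmetric])
qed

end

context planar_diagram
begin

lemma BN_dim_eq_cut: "BN_dim D i = card {E \<in> saturated (arcs D) (strand D). cut E = i}"
proof -
  obtain W where "checkerboard W" using checkerboard_exists by blast
  then interpret checkerboard_diagram D W by unfold_locales
  show ?thesis using BN_dim_eq card_generators by simp
qed

text \<open>
  A crossing between the components \<open>l \<in> E\<close> and \<open>m \<notin> E\<close> is counted for the pair \<open>(l, m)\<close> only, as \<open>(m, l)\<close> is
  not a pair of the sum.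
\<close>

lemma twice_linking_number:
  fixes k :: nat and L :: "nat \<Rightarrow> arc set"
  assumes L: "bij_betw L {1..k} (components D)" and E: "E \<subseteq> {1..k}"
  shows "2 * (\<Sum>l\<in>E. \<Sum>m\<in>{1..k} - E. lk D (L l) (L m)) = of_int (cut (\<Union> (L ` E)))"
proof -
  let ?u = "\<lambda>r. under_in (crossings D ! r)" and ?o = "\<lambda>r. over_in (crossings D ! r)"
  let ?s = "\<lambda>r. crossing_sign (crossings D ! r)"
  define between where "between l m r \<longleftrightarrow> ?u r \<in> L l \<and> ?o r \<in> L m \<or> ?u r \<in> L m \<and> ?o r \<in> L l" for l m r
  define comp where "comp a = inv_into {1..k} L {b. equivclp (strand D) a b}" for a
  have comp: "comp a \<in> {1..k}" "\<And>l. l \<in> {1..k} \<Longrightarrow> a \<in> L l \<longleftrightarrow> l = comp a" if a: "a \<in> arcs D" for a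
  proof -
    have cl: "{b. equivclp (strand D) a b} \<in> L ` {1..k}"
      using a bij_betw_imp_surj_on[OF L] by (auto simp: components_def generated_classes_eq)
    show c: "comp a \<in> {1..k}" unfolding comp_def by (rule inv_into_into[OF cl])
    have Lc: "L (comp a) = {b. equivclp (strand D) a b}" unfolding comp_def by (rule f_inv_into_f[OF cl])
    fix l assume l: "l \<in> {1..k}"
    have "L l \<in> components D" using l L bij_betwE by blast
    then obtain b where b: "L l = {c. equivclp (strand D) b c}"
      by (auto simp: components_def generated_classes_eq)
    have "a \<in> L l \<longleftrightarrow> L l = L (comp a)"
      unfolding b Lc equivclp_class_eq by simp
    thus "a \<in> L l \<longleftrightarrow> l = comp a"
      using bij_betw_imp_inj_on[OF L] l c by (auto dest: inj_onD)
  qed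
  have count: "(\<Sum>l\<in>E. \<Sum>m\<in>{1..k} - E. if between l m r then ?s r else 0) =
      (if (?u r \<in> \<Union> (L ` E)) \<noteq> (?o r \<in> \<Union> (L ` E)) then ?s r else 0)" if r: "r < n" for r
  proof -
    define u v where "u = comp (?u r)" and "v = comp (?o r)"
    have uv: "u \<in> {1..k}" "v \<in> {1..k}" using comp(1) in_arcs_at[OF r] by (simp_all add: u_def v_def)
    have U: "?u r \<in> L l \<longleftrightarrow> l = u" "?o r \<in> L l \<longleftrightarrow> l = v" if "l \<in> {1..k}" for l
      using comp(2) in_arcs_at[OF r] that by (simp_all add: u_def v_def)
    have inE: "?u r \<in> \<Union> (L ` E) \<longleftrightarrow> u \<in> E" "?o r \<in> \<Union> (L ` E) \<longleftrightarrow> v \<in> E"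
      using U E by blast+
    have fin: "finite E" by (rule finite_subset[OF E]) simp
    have "(\<Sum>l\<in>E. \<Sum>m\<in>{1..k} - E. if between l m r then ?s r else 0)
        = (\<Sum>l\<in>E. \<Sum>m\<in>{1..k} - E. (if m = v then if l = u then ?s r else 0 else 0) +
             (if m = u then if l = v then ?s r else 0 else 0))"
    proof (intro sum.cong refl)
      fix l m assume lm: "l \<in> E" "m \<in> {1..k} - E"
      hence "between l m r \<longleftrightarrow> l = u \<and> m = v \<or> m = u \<and> l = v"
        using U[of l] U[of m] E by (auto simp: between_def)
      moreover have "l \<noteq> m" using lm by auto
      ultimately show "(if between l m r then ?s r else 0) =
          (if m = v then if l = u then ?s r else 0 else 0) + (if m = u then if l = v then ?s r else 0 else 0)"
        by auto
    qed
    also have "\<dots> = (if v \<notin> E then if u \<in> E then ?s r else 0 else 0) + (if u \<notin> E then if v \<in> E then ?s r else 0 else 0)"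
      using fin uv by (simp add: sum.distrib)
    finally show ?thesis unfolding inE by auto
  qed
  have lk: "2 * lk D (L l) (L m) = of_int (\<Sum>r<n. if between l m r then ?s r else 0)" for l m
  proof -
    have "sum_list (map g (filter P xs)) = (\<Sum>r<length xs. if P (xs ! r) then g (xs ! r) else 0)"
      for g :: "crossing \<Rightarrow> int" and P xs
      unfolding sum_list_map_filter' by (simp add: sum_list_sum_nth atLeast0LessThan)
    thus ?thesis unfolding lk_def between_def by simp
  qed
  have "2 * (\<Sum>l\<in>E. \<Sum>m\<in>{1..k} - E. lk D (L l) (L m)) = (\<Sum>l\<in>E. \<Sum>m\<in>{1..k} - E. 2 * lk D (L l) (L m))"
    by (simp add: sum_distrib_left)
  also have "\<dots> = of_int (\<Sum>l\<in>E. \<Sum>m\<in>{1..k} - E. \<Sum>r<n. if between l m r then ?s r else 0)"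
    by (simp only: lk of_int_sum)
  also have "(\<Sum>l\<in>E. \<Sum>m\<in>{1..k} - E. \<Sum>r<n. if between l m r then ?s r else 0)
      = (\<Sum>r<n. \<Sum>l\<in>E. \<Sum>m\<in>{1..k} - E. if between l m r then ?s r else 0)"
    by (simp only: sum.swap[of _ "{..<n}"])
  also have "\<dots> = cut (\<Union> (L ` E))" unfolding cut_def using count by (intro sum.cong) auto
  finally show ?thesis .
qed

lemma bij_betw_unions_of_components:
  fixes k :: nat and L :: "nat \<Rightarrow> arc set"
  assumes L: "bij_betw L {1..k} (components D)"
  shows "bij_betw (\<lambda>E. \<Union> (L ` E)) (Pow {1..k}) (saturated (arcs D) (strand D))"
proof -
  have "bij_betw Union (Pow (components D)) (saturated (arcs D) (strand D))"
    unfolding components_def by (rule bij_betw_Union_classes[OF strand_arcs])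
  with bij_betw_Pow[OF L] have "bij_betw (Union \<circ> image L) (Pow {1..k}) (saturated (arcs D) (strand D))"
    by (rule bij_betw_trans)
  thus ?thesis by (simp add: comp_def)
qed

end

lemma sum_card_fibers:
  assumes "finite S"
  shows "(\<Sum>i | card {x \<in> S. f x = i} \<noteq> 0. card {x \<in> S. f x = i}) = card S"
proof -
  have "{i. card {x \<in> S. f x = i} \<noteq> 0} = f ` S" using assms by auto
  thus ?thesis using sum.image_gen[OF assms, of "\<lambda>_. 1::nat" f] by simp
qed

theorem theorem3p1:
  fixes D :: diagram and k :: nat and L :: "nat \<Rightarrow> arc set"
  assumes "link_diagram D"
    and "bij_betw L {1..k} (components D)"
  shows "(\<Sum>i | BN_dim D i \<noteq> 0. BN_dim D i) = 2 ^ k \<and>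
    (\<forall>i::int. BN_dim D i =
       card {E. E \<subseteq> {1..k} \<and>
                2 * (\<Sum>l \<in> E. \<Sum>m \<in> {1..k} - E. lk D (L l) (L m)) = of_int i})"
proof -
  interpret planar_diagram D by unfold_locales (rule assms(1))
  let ?U = "\<lambda>E. \<Union> (L ` E)"
  have dim: "BN_dim D i = card {E \<in> Pow {1..k}. cut (?U E) = i}" for i
  proof -
    have bij: "bij_betw ?U (Pow {1..k}) (saturated (arcs D) (strand D))"
      by (rule bij_betw_unions_of_components[OF assms(2)])
    have "?U ` {E \<in> Pow {1..k}. cut (?U E) = i} = {E \<in> saturated (arcs D) (strand D). cut E = i}"
      unfolding bij_betw_imp_surj_on[OF bij, symmetric] by auto
    from this[symmetric] have "card {E \<in> saturated (arcs D) (strand D). cut E = i} =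
        card (?U ` {E \<in> Pow {1..k}. cut (?U E) = i})"
      by (rule arg_cong)
    also have "\<dots> = card {E \<in> Pow {1..k}. cut (?U E) = i}"
    proof (rule card_image)
      show "inj_on ?U {E \<in> Pow {1..k}. cut (?U E) = i}"
        by (rule inj_on_subset[OF bij_betw_imp_inj_on[OF bij]]) auto
    qed
    finally show ?thesis unfolding BN_dim_eq_cut .
  qed
  have "(\<Sum>i | BN_dim D i \<noteq> 0. BN_dim D i) = card (Pow {1..k})"
    unfolding dim by (rule sum_card_fibers) simp
  hence "(\<Sum>i | BN_dim D i \<noteq> 0. BN_dim D i) = 2 ^ k"
    by (simp only: card_Pow finite_atLeastAtMost card_atLeastAtMost diff_Suc_1)
  moreover have "BN_dim D i = card {E. E \<subseteq> {1..k} \<and>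
      2 * (\<Sum>l \<in> E. \<Sum>m \<in> {1..k} - E. lk D (L l) (L m)) = of_int i}" for i
  proof -
    have "2 * (\<Sum>l \<in> E. \<Sum>m \<in> {1..k} - E. lk D (L l) (L m)) = of_int i \<longleftrightarrow> cut (?U E) = i"
      if "E \<subseteq> {1..k}" for E
      unfolding twice_linking_number[OF assms(2) that] by (rule of_int_eq_iff)
    hence "{E \<in> Pow {1..k}. cut (?U E) = i} = {E. E \<subseteq> {1..k} \<and>
        2 * (\<Sum>l \<in> E. \<Sum>m \<in> {1..k} - E. lk D (L l) (L m)) = of_int i}"
      by blast
    thus ?thesis unfolding dim by (rule arg_cong)
  qed
  ultimately show ?thesis by blast
qed

end
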